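(* Let $m,n$ be integers with $\min(m,n)\ge 2$, let $a\in\mathbb{R}_+^m$ and $b\in\mathbb{R}_+^n$ be probability vectors with (strictly) positive entries, and let $K\in\mathbb{R}_+^{m\times n}$ be a matrix with (strictly) positive entries such that $\operatorname{rank}(K)=\min(m,n)$. Let $\vartheta^2$, $\Lambda(K)$ and $\delta_{K,a,b}$ be the quantities defined in the context. Then: (i) For any $\omega$ with $1<\omega<1+\vartheta^2$, the asymptotic local convergence rate of the modified Sinkhorn method with parameter $\omega$ is faster (that is, strictly smaller) than that of the standard Sinkhorn method, i.e. than that of the same method with $\omega=1$. (ii) For any $\omega$ with $1<\omega<\min\left(1+\delta_{K,a,b},\ \frac{2}{1+\Lambda(K)}\right)$, the modified Sinkhorn method with parameter $\omega$ is both globally convergent and asymptotically faster than the standard Sinkhorn method (i.e. its asymptotic local convergence rate is strictly smaller than that for $\omega=1$).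
   Context: $\mathbb{R}_+$ denotes the (strictly) positive reals. For vectors of equal dimension, $x\circ y$ is the componentwise product and $x/y$ the componentwise quotient; powers of vectors are componentwise. Problem: find $(u,v)\in\mathbb{R}_+^m\times\mathbb{R}_+^n$ with $u\circ Kv=a$ and $v\circ K^{\mathsf T}u=b$. By a classical theorem of Sinkhorn a solution $(u^*,v^* )$ exists and is unique up to rescaling $(tu^*,t^{-1}v^* )$, $t>0$. Modified Sinkhorn method with relaxation parameter $\omega>0$: starting from $(u_0,v_0)\in\mathbb{R}_+^m\times\mathbb{R}_+^n$, $$u_{\ell+1}=u_\ell^{1-\omega}\circ\left(\frac{a}{Kv_\ell}\right)^{\omega},\qquad v_{\ell+1}=v_\ell^{1-\omega}\circ\left(\frac{b}{K^{\mathsf T}u_{\ell+1}}\right)^{\omega}.$$ The standard Sinkhorn method is the case $\omega=1$. Compositional data space: $\mathcal{C}^m=\mathbb{R}_+^m/\!\sim$, where $x\sim x'$ iff $x=tx'$ for some $t>0$; the class of $x$ is $\underline{x}$. With $\underline{x}+\underline{y}:=\underline{x\circ y}$ and $\gamma\cdot\underline{x}:=\underline{x^\gamma}$ ($\gamma\in\mathbb{R}$) it is a real vector space of dimension $m-1$, normed by $\|\underline{x}\|_H=\log\max_{i,j}\frac{x_i}{x_j}$; $\mathcal{C}^n$ is defined analogously. The modified Sinkhorn method induces an iteration $(\underline{u}_{\ell+1},\underline{v}_{\ell+1})=\mathcal{F}_\omega(\underline{u}_\ell,\underline{v}_\ell)$ on $\mathcal{C}^m\times\mathcal{C}^n$,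 namely $$\underline{u}_{\ell+1}=(1-\omega)\cdot\underline{u}_\ell+\omega\cdot\underline{a}-\omega\cdot\underline{Kv_\ell},\qquad \underline{v}_{\ell+1}=(1-\omega)\cdot\underline{v}_\ell+\omega\cdot\underline{b}-\omega\cdot\underline{K^{\mathsf T}u_{\ell+1}},$$ which has $(\underline{u}^*,\underline{v}^* )$ as its unique fixed point. Convergence of the method is understood in $\mathcal{C}^m\times\mathcal{C}^n$: the method is globally convergent if for every starting point $(\underline{u}_\ell,\underline{v}_\ell)\to(\underline{u}^*,\underline{v}^* )$. The asymptotic local (R-linear) convergence rate of the method with parameter $\omega$ is the spectral radius of the derivative $\mathcal{F}_\omega'(\underline{u}^*,\underline{v}^* )$, a linear map on $\mathcal{C}^m\times\mathcal{C}^n$. Quantity $\vartheta^2$: let $P_*=\operatorname{diag}(u^* )K\operatorname{diag}(v^* )$ and $M=\operatorname{diag}(1/a)\,P_*\operatorname{diag}(1/b)\,P_*^{\mathsf T}\in\mathbb{R}^{m\times m}$. $M$ has real nonnegative eigenvalues, the largest being $1$; $\vartheta^2\in[0,1)$ (with $\vartheta\ge 0$) denotes the second largest eigenvalue of $M$ (counted with multiplicity). Birkhoff contraction ratio: $\eta(K)=\max_{i,j,k,\ell}\frac{K_{ik}K_{j\ell}}{K_{jk}K_{i\ell}}$ and $\Lambda(K)=\frac{\sqrt{\eta(K)}-1}{\sqrt{\eta(K)}+1}$. Quantity $\delta_{K,a,b}$: with $\sigma_{\min}(K)$ the smallest positive singular value of $K$, $\|A\|_\infty=\max_{\|x\|_\infty=1}\|Ax\|_\infty$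 for a matrix $A$, and subscripts $\min,\max$ denoting the smallest and largest entry of a vector, set $$\delta_1=\frac{a_{\min}}{b_{\max}}\cdot\frac{1-b_{\max}}{\left(\frac{\|K\|_\infty}{\sigma_{\min}(K)}\right)^2-a_{\min}},\qquad \delta_2=\frac{b_{\min}}{a_{\max}}\cdot\frac{1-a_{\max}}{\left(\frac{\|K^{\mathsf T}\|_\infty}{\sigma_{\min}(K)}\right)^2-b_{\min}},$$ and $\delta_{K,a,b}=\delta_1$ if $m>n$, $\delta_{K,a,b}=\delta_2$ if $m<n$, $\delta_{K,a,b}=\max(\delta_1,\delta_2)$ if $m=n$. *)

theory Defs
  imports
    "HOL-Analysis.Analysis"
    "HOL-Computational_Algebra.Computational_Algebra"
begin

section \<open>Componentwise operations on vectors\<close>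

text \<open>The componentwise product is the library's \<^term>\<open>x * y\<close> on vectors.\<close>

definition positive_vec :: "real^'m \<Rightarrow> bool" where
  "positive_vec x \<longleftrightarrow> (\<forall>i. 0 < x $ i)"

definition vec_divide :: "real^'m \<Rightarrow> real^'m \<Rightarrow> real^'m" where
  "vec_divide x y = (\<chi> i. x $ i / y $ i)"

definition vec_powr :: "real^'m \<Rightarrow> real \<Rightarrow> real^'m" where
  "vec_powr x r = (\<chi> i. (x $ i) powr r)"

definition max_entry :: "real^'m \<Rightarrow> real" where
  "max_entry x = Max (range (\<lambda>i. x $ i))"

definition min_entry :: "real^'m \<Rightarrow> real" where
  "min_entry x = Min (range (\<lambda>i. x $ i))"

definition diag_mat :: "real^'m \<Rightarrow> real^'m^'m" where
  "diag_mat x = (\<chi> i j. if i = j then x $ i else 0)"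

definition positive_mat :: "real^'n^'m \<Rightarrow> bool" where
  "positive_mat K \<longleftrightarrow> (\<forall>i j. 0 < K $ i $ j)"

definition probability_vec :: "real^'m \<Rightarrow> bool" where
  "probability_vec x \<longleftrightarrow> (\<forall>i. 0 \<le> x $ i) \<and> (\<Sum>i\<in>UNIV. x $ i) = 1"

lemma positive_vec_mult: "positive_vec x \<Longrightarrow> positive_vec y \<Longrightarrow> positive_vec (x * y)"
  by (simp add: positive_vec_def)

lemma positive_vec_divide: "positive_vec x \<Longrightarrow> positive_vec y \<Longrightarrow> positive_vec (vec_divide x y)"
  by (simp add: positive_vec_def vec_divide_def)

lemma positive_vec_powr: "positive_vec x \<Longrightarrow> positive_vec (vec_powr x r)"
  by (simp add: positive_vec_def vec_powr_def) (metis less_irrefl)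

lemma positive_vec_one: "positive_vec 1"
  by (simp add: positive_vec_def)

lemma positive_mat_vec:
  assumes "positive_mat K" "positive_vec x"
  shows "positive_vec (K *v x)"
  using assms unfolding positive_mat_def positive_vec_def matrix_vector_mult_def
  by (auto intro!: sum_pos mult_pos_pos)

lemma positive_mat_transpose: "positive_mat K \<Longrightarrow> positive_mat (transpose K)"
  by (simp add: positive_mat_def transpose_def)


section \<open>Compositional data space\<close>

definition ray_rel :: "real^'m \<Rightarrow> real^'m \<Rightarrow> bool" where
  "ray_rel x y \<longleftrightarrow> positive_vec x \<and> positive_vec y \<and> (\<exists>t>0. x = t *\<^sub>R y)"

lemma ray_rel_part_equivp: "part_equivp ray_rel"
proof (rule part_equivpI)
  have "ray_rel (1 :: real^'m) 1"
    unfolding ray_rel_def using positive_vec_one by (metis scaleR_one zero_less_one)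
  then show "\<exists>x :: real^'m. ray_rel x x" by blast
  show "symp (ray_rel :: real^'m \<Rightarrow> _)"
  proof (rule sympI)
    fix x y :: "real^'m" assume "ray_rel x y"
    then obtain t where t: "positive_vec x" "positive_vec y" "t > 0" "x = t *\<^sub>R y"
      unfolding ray_rel_def by blast
    have "y = inverse t *\<^sub>R x" using t by simp
    with t show "ray_rel y x" unfolding ray_rel_def by (metis positive_imp_inverse_positive)
  qed
  show "transp (ray_rel :: real^'m \<Rightarrow> _)"
  proof (rule transpI)
    fix x y z :: "real^'m" assume "ray_rel x y" "ray_rel y z"
    then obtain s t where "positive_vec x" "positive_vec z" "s > 0" "t > 0"
      "x = s *\<^sub>R y" "y = t *\<^sub>R z"
      unfolding ray_rel_def by blast
    then show "ray_rel x z" unfolding ray_rel_def by (metis mult_pos_pos scaleR_scaleR)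
  qed
qed

quotient_type 'm compositional = "real^'m" / partial: ray_rel
  by (rule ray_rel_part_equivp)

text \<open>The class of a vector; it is meaningful for positive vectors only.\<close>

definition ray_class :: "real^'m \<Rightarrow> 'm compositional" where
  "ray_class x = abs_compositional x"

lemma ray_rel_iff:
  "ray_rel x y \<longleftrightarrow> positive_vec x \<and> positive_vec y \<and> (\<exists>c. \<forall>i. ln (x $ i) = c + ln (y $ i))"
proof
  assume "ray_rel x y"
  then obtain t where t: "positive_vec x" "positive_vec y" "t > 0" "x = t *\<^sub>R y"
    unfolding ray_rel_def by blast
  then have "t \<noteq> 0" "y $ i \<noteq> 0" for i
    unfolding positive_vec_def by (metis less_irrefl)+
  then have "\<forall>i. ln (x $ i) = ln t + ln (y $ i)"
    using t by (simp add: positive_vec_def ln_mult)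
  with t show "positive_vec x \<and> positive_vec y \<and> (\<exists>c. \<forall>i. ln (x $ i) = c + ln (y $ i))"
    by blast
next
  assume a: "positive_vec x \<and> positive_vec y \<and> (\<exists>c. \<forall>i. ln (x $ i) = c + ln (y $ i))"
  then obtain c where c: "\<forall>i. ln (x $ i) = c + ln (y $ i)" by blast
  have "x $ i = exp c * y $ i" for i
    using a c by (metis exp_add exp_ln positive_vec_def)
  then have "x = exp c *\<^sub>R y" by (simp add: vec_eq_iff)
  with a show "ray_rel x y" unfolding ray_rel_def using exp_gt_zero[of c] by blast
qed

lemma ray_class_eq_iff:
  assumes "positive_vec x" "positive_vec y"
  shows "ray_class x = ray_class y \<longleftrightarrow> (\<exists>t>0. x = t *\<^sub>R y)"
proof -
  have refl: "ray_rel x x" "ray_rel y y"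
    using assms unfolding ray_rel_iff by (auto intro!: exI[of _ 0])
  have "ray_class x = ray_class y \<longleftrightarrow> ray_rel x y"
    unfolding ray_class_def using refl Quotient3_rel[OF Quotient3_compositional, of x y] by simp
  then show ?thesis using assms by (simp add: ray_rel_def)
qed

instantiation compositional :: (finite) ab_group_add
begin

lift_definition zero_compositional :: "'a compositional" is "1 :: real^'a"
  by (auto simp: ray_rel_iff positive_vec_one intro!: exI[of _ 0])

lift_definition plus_compositional ::
    "'a compositional \<Rightarrow> 'a compositional \<Rightarrow> 'a compositional"
  is "\<lambda>x y :: real^'a. x * y"
proof -
  fix x x' y y' :: "real^'a"
  assume "ray_rel x x'" "ray_rel y y'"
  then obtain c d where *: "positive_vec x" "positive_vec x'" "positive_vec y" "positive_vec y'"
    "\<forall>i. ln (x $ i) = c + ln (x' $ i)" "\<forall>i. ln (y $ i) = d + ln (y' $ i)"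
    unfolding ray_rel_iff by blast
  have "\<forall>i. ln ((x * y) $ i) = (c + d) + ln ((x' * y') $ i)"
    using * by (simp add: positive_vec_def ln_mult less_imp_neq[symmetric])
  with * show "ray_rel (x * y) (x' * y')"
    unfolding ray_rel_iff by (auto intro: positive_vec_mult)
qed

lift_definition uminus_compositional :: "'a compositional \<Rightarrow> 'a compositional"
  is "\<lambda>x :: real^'a. vec_powr x (-1)"
proof -
  fix x y :: "real^'a"
  assume "ray_rel x y"
  then obtain c where *: "positive_vec x" "positive_vec y" "\<forall>i. ln (x $ i) = c + ln (y $ i)"
    unfolding ray_rel_iff by blast
  have ln: "ln (vec_powr z (-1) $ i) = - ln (z $ i)" if "positive_vec z" for z :: "real^'a" and i
  proof -
    have "ln ((z $ i) powr (-1)) = (-1) * ln (z $ i)" by (simp only: ln_powr)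
    then have "ln ((z $ i) powr (-1)) = - ln (z $ i)" by simp
    then show ?thesis by (simp only: vec_powr_def vec_lambda_beta)
  qed
  have "\<forall>i. ln (vec_powr x (-1) $ i) = - c + ln (vec_powr y (-1) $ i)"
    using * by (simp add: ln)
  with * show "ray_rel (vec_powr x (-1)) (vec_powr y (-1))"
    unfolding ray_rel_iff using positive_vec_powr by blast
qed

definition minus_compositional ::
    "'a compositional \<Rightarrow> 'a compositional \<Rightarrow> 'a compositional" where
  "minus_compositional X Y = X + (- Y)"

instance
proof
  fix X Y Z :: "'a compositional"
  show "X + Y + Z = X + (Y + Z)"
    by transfer (auto simp: ray_rel_iff positive_vec_mult mult.assoc intro!: exI[of _ 0])
  show "X + Y = Y + X"
    by transfer (auto simp: ray_rel_iff positive_vec_mult mult.commute intro!: exI[of _ 0])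
  show "0 + X = X"
    by transfer (auto simp: ray_rel_iff positive_vec_mult positive_vec_one intro!: exI[of _ 0])
  show "- X + X = 0"
  proof transfer
    fix x :: "real^'a" assume "ray_rel x x"
    then have x: "positive_vec x" by (simp add: ray_rel_iff)
    then have "vec_powr x (-1) * x = 1"
      by (auto simp: vec_eq_iff vec_powr_def positive_vec_def powr_minus powr_one less_imp_le
          less_imp_neq[symmetric])
    then show "ray_rel (vec_powr x (-1) * x) 1"
      by (auto simp: ray_rel_iff positive_vec_one intro!: exI[of _ 0])
  qed
  show "X - Y = X + - Y" by (simp add: minus_compositional_def)
qed

end

instantiation compositional :: (finite) real_vector
begin

lift_definition scaleR_compositional :: "real \<Rightarrow> 'a compositional \<Rightarrow> 'a compositional"
  is "\<lambda>r x :: real^'a. vec_powr x r"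
proof -
  fix r :: real and x y :: "real^'a"
  assume "ray_rel x y"
  then obtain c where *: "positive_vec x" "positive_vec y" "\<forall>i. ln (x $ i) = c + ln (y $ i)"
    unfolding ray_rel_iff by blast
  then have "\<forall>i. ln (vec_powr x r $ i) = r * c + ln (vec_powr y r $ i)"
    by (simp add: vec_powr_def positive_vec_def ln_powr less_imp_neq[symmetric] algebra_simps)
  with * show "ray_rel (vec_powr x r) (vec_powr y r)"
    unfolding ray_rel_iff by (auto intro: positive_vec_powr)
qed

instance
proof
  fix r s :: real and X Y :: "'a compositional"
  show "r *\<^sub>R (X + Y) = r *\<^sub>R X + r *\<^sub>R Y"
  proof transfer
    fix r :: real and x y :: "real^'a" assume "ray_rel x x" "ray_rel y y"
    then have xy: "positive_vec x" "positive_vec y" by (auto simp: ray_rel_iff)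
    then have "vec_powr (x * y) r = vec_powr x r * vec_powr y r"
      by (simp add: vec_eq_iff vec_powr_def positive_vec_def powr_mult less_imp_le)
    with xy show "ray_rel (vec_powr (x * y) r) (vec_powr x r * vec_powr y r)"
      by (auto simp: ray_rel_iff positive_vec_mult positive_vec_powr intro!: exI[of _ 0])
  qed
  show "(r + s) *\<^sub>R X = r *\<^sub>R X + s *\<^sub>R X"
  proof transfer
    fix r s :: real and x :: "real^'a" assume "ray_rel x x"
    then have x: "positive_vec x" by (simp add: ray_rel_iff)
    have "vec_powr x (r + s) = vec_powr x r * vec_powr x s"
      by (simp add: vec_eq_iff vec_powr_def powr_add)
    with x show "ray_rel (vec_powr x (r + s)) (vec_powr x r * vec_powr x s)"
      by (auto simp: ray_rel_iff positive_vec_mult positive_vec_powr intro!: exI[of _ 0])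
  qed
  show "r *\<^sub>R s *\<^sub>R X = (r * s) *\<^sub>R X"
  proof transfer
    fix r s :: real and x :: "real^'a" assume "ray_rel x x"
    then have x: "positive_vec x" by (simp add: ray_rel_iff)
    have "vec_powr (vec_powr x s) r = vec_powr x (r * s)"
      by (simp add: vec_eq_iff vec_powr_def powr_powr mult.commute)
    with x show "ray_rel (vec_powr (vec_powr x s) r) (vec_powr x (r * s))"
      by (auto simp: ray_rel_iff positive_vec_powr intro!: exI[of _ 0])
  qed
  show "1 *\<^sub>R X = X"
  proof transfer
    fix x :: "real^'a" assume x: "ray_rel x x"
    then have "vec_powr x 1 = x"
      by (simp add: vec_eq_iff vec_powr_def ray_rel_iff positive_vec_def less_imp_le)
    with x show "ray_rel (vec_powr x 1) x" by simp
  qed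
qed

end

definition hilbert_norm :: "real^'m \<Rightarrow> real" where
  "hilbert_norm x = ln (Max (range (\<lambda>(i, j). x $ i / x $ j)))"

lemma hilbert_norm_upper:
  fixes x :: "real^'m"
  assumes "positive_vec x"
  shows "ln (x $ i) - ln (x $ j) \<le> hilbert_norm x"
proof -
  have pos: "0 < x $ i" "0 < x $ j" using assms by (auto simp: positive_vec_def)
  have "x $ i / x $ j \<in> range (\<lambda>(i, j). x $ i / x $ j)" by (auto intro: image_eqI[of _ _ "(i, j)"])
  then have le: "x $ i / x $ j \<le> Max (range (\<lambda>(i, j). x $ i / x $ j))" by (intro Max_ge) auto
  have "ln (x $ i) - ln (x $ j) = ln (x $ i / x $ j)" using pos by (simp add: ln_div)
  also have "\<dots> \<le> hilbert_norm x"
    unfolding hilbert_norm_def using le pos by (metis divide_pos_pos ln_le_cancel_iff order_less_le_trans)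
  finally show ?thesis .
qed

lemma hilbert_norm_attained:
  fixes x :: "real^'m"
  assumes "positive_vec x"
  shows "\<exists>i j. hilbert_norm x = ln (x $ i) - ln (x $ j)"
proof -
  have "Max (range (\<lambda>(i, j). x $ i / x $ j)) \<in> range (\<lambda>(i, j). x $ i / x $ j)"
    by (intro Max_in) auto
  then obtain i j where ij: "Max (range (\<lambda>(i, j). x $ i / x $ j)) = x $ i / x $ j" by force
  have "hilbert_norm x = ln (x $ i) - ln (x $ j)"
    unfolding hilbert_norm_def ij using assms by (simp add: positive_vec_def ln_div less_imp_neq[symmetric])
  then show ?thesis by blast
qed

lemma hilbert_norm_ray_rel:
  assumes "ray_rel x y"
  shows "hilbert_norm x = hilbert_norm y"
proof -
  obtain c where *: "positive_vec x" "positive_vec y" "\<forall>i. ln (x $ i) = c + ln (y $ i)"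
    using assms unfolding ray_rel_iff by blast
  obtain i j where x: "hilbert_norm x = ln (x $ i) - ln (x $ j)"
    using hilbert_norm_attained[OF *(1)] by blast
  obtain k l where y: "hilbert_norm y = ln (y $ k) - ln (y $ l)"
    using hilbert_norm_attained[OF *(2)] by blast
  show ?thesis
    using hilbert_norm_upper[OF *(2), of i j] hilbert_norm_upper[OF *(1), of k l] *(3) x y by simp
qed

instantiation compositional :: (finite) real_normed_vector
begin

lift_definition norm_compositional :: "'a compositional \<Rightarrow> real" is hilbert_norm
  by (rule hilbert_norm_ray_rel)

definition sgn_compositional :: "'a compositional \<Rightarrow> 'a compositional" where
  "sgn_compositional X = inverse (norm X) *\<^sub>R X"

definition dist_compositional :: "'a compositional \<Rightarrow> 'a compositional \<Rightarrow> real" where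
  "dist_compositional X Y = norm (X - Y)"

definition uniformity_compositional :: "('a compositional \<times> 'a compositional) filter" where
  "uniformity_compositional = (INF e\<in>{0 <..}. principal {(x, y). dist x y < e})"

definition open_compositional :: "'a compositional set \<Rightarrow> bool" where
  "open_compositional U \<longleftrightarrow> (\<forall>x\<in>U. \<forall>\<^sub>F (x', y) in uniformity. x' = x \<longrightarrow> y \<in> U)"

instance
proof
  fix r :: real and X Y :: "'a compositional" and U :: "'a compositional set"
  show "dist X Y = norm (X - Y)" by (rule dist_compositional_def)
  show "sgn X = X /\<^sub>R norm X" by (simp add: sgn_compositional_def)
  show "uniformity = (INF e\<in>{0 <..}. principal {(x :: 'a compositional, y). dist x y < e})"
    by (rule uniformity_compositional_def)
  show "open U \<longleftrightarrow> (\<forall>x\<in>U. \<forall>\<^sub>F (x', y) in uniformity. x' = x \<longrightarrow> y \<in> U)"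
    by (rule open_compositional_def)
  show "norm X = 0 \<longleftrightarrow> X = 0"
  proof transfer
    fix x :: "real^'a" assume "ray_rel x x"
    then have x: "positive_vec x" by (simp add: ray_rel_iff)
    show "hilbert_norm x = 0 \<longleftrightarrow> ray_rel x 1"
    proof
      assume "hilbert_norm x = 0"
      then have "ln (x $ i) \<le> ln (x $ j)" for i j
        using hilbert_norm_upper[OF x, of i j] by simp
      then have "\<exists>c. \<forall>i. ln (x $ i) = c" by (metis order_antisym)
      then show "ray_rel x 1" using x by (simp add: ray_rel_iff positive_vec_one)
    next
      assume "ray_rel x 1"
      then obtain c where "\<forall>i. ln (x $ i) = c" by (auto simp: ray_rel_iff)
      then show "hilbert_norm x = 0" using hilbert_norm_attained[OF x] by auto
    qed
  qed
  show "norm (X + Y) \<le> norm X + norm Y"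
  proof transfer
    fix x y :: "real^'a" assume "ray_rel x x" "ray_rel y y"
    then have x: "positive_vec x" and y: "positive_vec y" by (auto simp: ray_rel_iff)
    obtain i j where "hilbert_norm (x * y) = ln ((x * y) $ i) - ln ((x * y) $ j)"
      using hilbert_norm_attained[OF positive_vec_mult[OF x y]] by blast
    moreover have "ln ((x * y) $ k) = ln (x $ k) + ln (y $ k)" for k
      using x y by (simp add: positive_vec_def ln_mult less_imp_neq[symmetric])
    ultimately show "hilbert_norm (x * y) \<le> hilbert_norm x + hilbert_norm y"
      using hilbert_norm_upper[OF x, of i j] hilbert_norm_upper[OF y, of i j] by simp
  qed
  show "norm (r *\<^sub>R X) = \<bar>r\<bar> * norm X"
  proof transfer
    fix r :: real and x :: "real^'a" assume "ray_rel x x"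
    then have x: "positive_vec x" by (simp add: ray_rel_iff)
    let ?y = "vec_powr x r"
    have y: "positive_vec ?y" using x by (rule positive_vec_powr)
    have ln: "ln (?y $ k) = r * ln (x $ k)" for k
      using x by (simp add: vec_powr_def positive_vec_def ln_powr less_imp_neq[symmetric])
    obtain i j where ij: "hilbert_norm ?y = r * (ln (x $ i) - ln (x $ j))"
      using hilbert_norm_attained[OF y] by (auto simp: ln right_diff_distrib)
    obtain k l where kl: "hilbert_norm x = ln (x $ k) - ln (x $ l)"
      using hilbert_norm_attained[OF x] by blast
    have u: "r * (ln (x $ p) - ln (x $ q)) \<le> hilbert_norm ?y" for p q
      using hilbert_norm_upper[OF y, of p q] by (simp add: ln right_diff_distrib)
    have "\<bar>ln (x $ i) - ln (x $ j)\<bar> \<le> hilbert_norm x"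
      using hilbert_norm_upper[OF x, of i j] hilbert_norm_upper[OF x, of j i] by linarith
    then have "\<bar>r\<bar> * \<bar>ln (x $ i) - ln (x $ j)\<bar> \<le> \<bar>r\<bar> * hilbert_norm x"
      by (intro mult_left_mono) auto
    then have "hilbert_norm ?y \<le> \<bar>r\<bar> * hilbert_norm x"
      unfolding ij by (metis abs_ge_self abs_mult order_trans)
    moreover have "\<bar>r\<bar> * hilbert_norm x \<le> hilbert_norm ?y"
      using u[of k l] u[of l k] unfolding kl by (cases "r \<ge> 0") (auto simp: algebra_simps)
    ultimately show "hilbert_norm ?y = \<bar>r\<bar> * hilbert_norm x" by simp
  qed
qed

end

text \<open>The vector space operations and the norm, evaluated on positive representatives.\<close>

lemma ray_rel_refl: "positive_vec x \<Longrightarrow> ray_rel x x"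
  by (auto simp: ray_rel_iff intro!: exI[of _ 0])

lemma ray_class_plus:
  "positive_vec x \<Longrightarrow> positive_vec y \<Longrightarrow> ray_class x + ray_class y = ray_class (x * y)"
  unfolding ray_class_def by (rule plus_compositional.abs_eq) (auto intro: ray_rel_refl)

lemma ray_class_scaleR: "positive_vec x \<Longrightarrow> r *\<^sub>R ray_class x = ray_class (vec_powr x r)"
  unfolding ray_class_def by (rule scaleR_compositional.abs_eq) (auto intro: ray_rel_refl)

lemma norm_ray_class:
  "positive_vec x \<Longrightarrow> norm (ray_class x) = ln (Max (range (\<lambda>(i, j). x $ i / x $ j)))"
  unfolding ray_class_def hilbert_norm_def[symmetric]
  by (rule norm_compositional.abs_eq) (auto intro: ray_rel_refl)

lemma ray_class_minus:
  assumes "positive_vec x" "positive_vec y"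
  shows "ray_class x - ray_class y = ray_class (vec_divide x y)"
proof -
  have "- ray_class y = ray_class (vec_powr y (-1))"
    using ray_class_scaleR[OF assms(2), of "-1"] by simp
  moreover have "x * vec_powr y (-1) = vec_divide x y"
    using assms by (simp add: vec_eq_iff vec_powr_def vec_divide_def positive_vec_def
        powr_minus divide_inverse less_imp_le)
  ultimately show ?thesis
    using ray_class_plus[OF assms(1) positive_vec_powr[OF assms(2)]]
    by (metis diff_conv_add_uminus)
qed

lemma rep_compositional_positive: "positive_vec (rep_compositional X)"
  using Quotient3_rep_reflp[OF Quotient3_compositional, of X] by (simp add: ray_rel_def)

lemma ray_class_rep: "ray_class (rep_compositional X) = X"
  unfolding ray_class_def by (rule Quotient3_abs_rep[OF Quotient3_compositional])

text \<open>
  The projective action \<open>[x] \<mapsto> [K x]\<close>; it does not depend on the chosen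
  representative when \<open>K\<close> has positive entries.
\<close>

definition mat_class :: "real^'n^'m \<Rightarrow> 'n compositional \<Rightarrow> 'm compositional" where
  "mat_class K X = ray_class (K *v rep_compositional X)"

lemma mat_class_ray_class:
  assumes "positive_mat K" "positive_vec x"
  shows "mat_class K (ray_class x) = ray_class (K *v x)"
proof -
  let ?y = "rep_compositional (ray_class x)"
  obtain t where t: "t > 0" "?y = t *\<^sub>R x"
    using ray_class_rep[of "ray_class x"] ray_class_eq_iff[OF rep_compositional_positive assms(2)]
    by auto
  then have "K *v ?y = t *\<^sub>R (K *v x)" by (simp add: matrix_vector_mult_scaleR)
  then show ?thesis
    unfolding mat_class_def
    using ray_class_eq_iff positive_mat_vec[OF assms] positive_mat_vec[OF assms(1) rep_compositional_positive] t(1)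
    by blast
qed


section \<open>The modified Sinkhorn method\<close>

definition sinkhorn_solution ::
    "real^'n^'m \<Rightarrow> real^'m \<Rightarrow> real^'n \<Rightarrow> real^'m \<Rightarrow> real^'n \<Rightarrow> bool" where
  "sinkhorn_solution K a b u v \<longleftrightarrow>
     positive_vec u \<and> positive_vec v \<and> u * (K *v v) = a \<and> v * (transpose K *v u) = b"

text \<open>
  A choice of \<open>(u*, v*)\<close>, which is unique only up to rescaling \<open>(t u*, v* / t)\<close>.
  All quantities below depend on it only through invariants of this rescaling.
\<close>

definition sinkhorn_sol :: "real^'n^'m \<Rightarrow> real^'m \<Rightarrow> real^'n \<Rightarrow> (real^'m) \<times> (real^'n)" where
  "sinkhorn_sol K a b = (SOME (u, v). sinkhorn_solution K a b u v)"

definition sinkhorn_step ::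
    "real \<Rightarrow> real^'n^'m \<Rightarrow> real^'m \<Rightarrow> real^'n \<Rightarrow> (real^'m) \<times> (real^'n) \<Rightarrow> (real^'m) \<times> (real^'n)" where
  "sinkhorn_step \<omega> K a b = (\<lambda>(u, v).
     let u' = vec_powr u (1 - \<omega>) * vec_powr (vec_divide a (K *v v)) \<omega>;
         v' = vec_powr v (1 - \<omega>) * vec_powr (vec_divide b (transpose K *v u')) \<omega>
     in (u', v'))"

definition sinkhorn_iter ::
    "real \<Rightarrow> real^'n^'m \<Rightarrow> real^'m \<Rightarrow> real^'n \<Rightarrow> (real^'m) \<times> (real^'n) \<Rightarrow> nat \<Rightarrow> (real^'m) \<times> (real^'n)" where
  "sinkhorn_iter \<omega> K a b z l = (sinkhorn_step \<omega> K a b ^^ l) z"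

definition pair_class :: "(real^'m) \<times> (real^'n) \<Rightarrow> 'm compositional \<times> 'n compositional" where
  "pair_class = (\<lambda>(u, v). (ray_class u, ray_class v))"

definition sinkhorn_map ::
    "real \<Rightarrow> real^'n^'m \<Rightarrow> real^'m \<Rightarrow> real^'n \<Rightarrow>
      'm compositional \<times> 'n compositional \<Rightarrow> 'm compositional \<times> 'n compositional" where
  "sinkhorn_map \<omega> K a b = (\<lambda>(U, V).
     let U' = (1 - \<omega>) *\<^sub>R U + \<omega> *\<^sub>R ray_class a - \<omega> *\<^sub>R mat_class K V;
         V' = (1 - \<omega>) *\<^sub>R V + \<omega> *\<^sub>R ray_class b - \<omega> *\<^sub>R mat_class (transpose K) U'
     in (U', V'))"

text \<open>The map on classes is the one induced by the method on positive vectors.\<close>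

lemma ray_class_relax:
  assumes "positive_vec x" "positive_vec y" "positive_vec z"
  shows "ray_class (vec_powr x (1 - \<omega>) * vec_powr (vec_divide y z) \<omega>) =
         (1 - \<omega>) *\<^sub>R ray_class x + \<omega> *\<^sub>R ray_class y - \<omega> *\<^sub>R ray_class z"
  using assms
  by (simp add: ray_class_plus[symmetric] ray_class_scaleR[symmetric] ray_class_minus[symmetric]
      positive_vec_powr positive_vec_divide scaleR_diff_right)

lemma sinkhorn_map_pair_class:
  assumes "positive_mat K" "positive_vec a" "positive_vec b" "positive_vec u" "positive_vec v"
  shows "sinkhorn_map \<omega> K a b (pair_class (u, v)) = pair_class (sinkhorn_step \<omega> K a b (u, v))"
proof -
  define u' where "u' = vec_powr u (1 - \<omega>) * vec_powr (vec_divide a (K *v v)) \<omega>"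
  have Kt: "positive_mat (transpose K)" using assms(1) by (rule positive_mat_transpose)
  have Kv: "positive_vec (K *v v)" using assms by (intro positive_mat_vec)
  have u': "positive_vec u'" unfolding u'_def using assms Kv
    by (intro positive_vec_mult positive_vec_powr positive_vec_divide)
  have Ku: "positive_vec (transpose K *v u')" using Kt u' by (rule positive_mat_vec)
  have 1: "(1 - \<omega>) *\<^sub>R ray_class u + \<omega> *\<^sub>R ray_class a - \<omega> *\<^sub>R mat_class K (ray_class v) = ray_class u'"
    unfolding u'_def using assms Kv by (simp add: ray_class_relax mat_class_ray_class)
  show ?thesis
    unfolding sinkhorn_map_def pair_class_def sinkhorn_step_def Let_def prod.case 1 u'_def[symmetric]
    using assms Ku Kt u' by (simp add: ray_class_relax mat_class_ray_class)
qed

definition globally_convergent ::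
    "real \<Rightarrow> real^'n^'m \<Rightarrow> real^'m \<Rightarrow> real^'n \<Rightarrow> bool" where
  "globally_convergent \<omega> K a b \<longleftrightarrow>
     (\<forall>u v. positive_vec u \<longrightarrow> positive_vec v \<longrightarrow>
        (\<lambda>l. pair_class (sinkhorn_iter \<omega> K a b (u, v) l)) \<longlonglongrightarrow> pair_class (sinkhorn_sol K a b))"

text \<open>
  \<open>\<mu>\<close> is an eigenvalue of the complexification of the real-linear map \<open>f\<close>, with
  eigenvector \<open>x + \<i> y\<close>: the two equations are the real and imaginary parts of
  \<open>f x + \<i> f y = \<mu> (x + \<i> y)\<close>.
\<close>

definition complex_eigenvalue :: "('a :: real_vector \<Rightarrow> 'a) \<Rightarrow> complex \<Rightarrow> bool" where
  "complex_eigenvalue f \<mu> \<longleftrightarrow>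
     (\<exists>x y. (x \<noteq> 0 \<or> y \<noteq> 0) \<and>
        f x = Re \<mu> *\<^sub>R x - Im \<mu> *\<^sub>R y \<and> f y = Im \<mu> *\<^sub>R x + Re \<mu> *\<^sub>R y)"

definition spectral_radius :: "('a :: real_vector \<Rightarrow> 'a) \<Rightarrow> real" where
  "spectral_radius f = Sup {cmod \<mu> | \<mu>. complex_eigenvalue f \<mu>}"

definition local_rate :: "real \<Rightarrow> real^'n^'m \<Rightarrow> real^'m \<Rightarrow> real^'n \<Rightarrow> real" where
  "local_rate \<omega> K a b =
     spectral_radius (frechet_derivative (sinkhorn_map \<omega> K a b) (at (pair_class (sinkhorn_sol K a b))))"


section \<open>Spectral quantities and the Birkhoff ratio\<close>

definition char_poly_mat :: "real^'m^'m \<Rightarrow> real poly" where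
  "char_poly_mat A = det (\<chi> i j. (if i = j then [:0, 1:] else 0) - [:A $ i $ j:])"

text \<open>
  The second entry of the list of real eigenvalues of \<open>A\<close>, repeated according to
  (algebraic) multiplicity and in decreasing order.
\<close>

definition second_largest_eigenvalue :: "real^'m^'m \<Rightarrow> real" where
  "second_largest_eigenvalue A = rev (sorted_list_of_multiset (proots (char_poly_mat A))) ! 1"

definition sinkhorn_plan :: "real^'n^'m \<Rightarrow> real^'m \<Rightarrow> real^'n \<Rightarrow> real^'n^'m" where
  "sinkhorn_plan K a b =
     (case sinkhorn_sol K a b of (u, v) \<Rightarrow> diag_mat u ** K ** diag_mat v)"

definition theta_squared :: "real^'n^'m \<Rightarrow> real^'m \<Rightarrow> real^'n \<Rightarrow> real" where
  "theta_squared K a b = second_largest_eigenvalue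
     (diag_mat (vec_divide 1 a) ** sinkhorn_plan K a b **
      diag_mat (vec_divide 1 b) ** transpose (sinkhorn_plan K a b))"

definition birkhoff_eta :: "real^'n^'m \<Rightarrow> real" where
  "birkhoff_eta K =
     Max (range (\<lambda>(i, j, k, l). (K $ i $ k * K $ j $ l) / (K $ j $ k * K $ i $ l)))"

definition birkhoff_ratio :: "real^'n^'m \<Rightarrow> real" where
  "birkhoff_ratio K = (sqrt (birkhoff_eta K) - 1) / (sqrt (birkhoff_eta K) + 1)"

text \<open>The positive singular values are the positive square roots of eigenvalues of \<open>K\<^sup>T K\<close>.\<close>

definition min_singular_value :: "real^'n^'m \<Rightarrow> real" where
  "min_singular_value K =
     Min {\<sigma>. 0 < \<sigma> \<and> (\<exists>x. x \<noteq> 0 \<and> (transpose K ** K) *v x = \<sigma>\<^sup>2 *\<^sub>R x)}"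

definition mat_infnorm :: "real^'n^'m \<Rightarrow> real" where
  "mat_infnorm A = Sup {infnorm (A *v x) | x. infnorm x = 1}"

definition delta_1 :: "real^'n^'m \<Rightarrow> real^'m \<Rightarrow> real^'n \<Rightarrow> real" where
  "delta_1 K a b = min_entry a / max_entry b *
     ((1 - max_entry b) / ((mat_infnorm K / min_singular_value K)\<^sup>2 - min_entry a))"

definition delta_2 :: "real^'n^'m \<Rightarrow> real^'m \<Rightarrow> real^'n \<Rightarrow> real" where
  "delta_2 K a b = min_entry b / max_entry a *
     ((1 - max_entry a) / ((mat_infnorm (transpose K) / min_singular_value K)\<^sup>2 - min_entry b))"

definition delta :: "real^'n^'m \<Rightarrow> real^'m \<Rightarrow> real^'n \<Rightarrow> real" where
  "delta (K :: real^'n^'m) a b =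
     (if CARD('m) > CARD('n) then delta_1 K a b
      else if CARD('m) < CARD('n) then delta_2 K a b
      else max (delta_1 K a b) (delta_2 K a b))"

end

theory Submission
  imports Defs
begin

text \<open>
  In logarithmic coordinates, \<open>x \<mapsto> log (K exp x)\<close> has a row-stochastic derivative whose rows have
  pairwise cross-ratios at most \<open>\<eta>(K)\<close>. Averaging with two such rows contracts oscillations by
  \<open>\<Lambda>(K)\<close>, and the mean value theorem turns this into Birkhoff's contraction. It yields the solution
  via Banach's fixed point theorem, and for \<open>\<omega> \<ge> 1\<close> it makes the relaxed map a contraction with factor
  \<open>\<omega> - 1 + \<omega> \<Lambda>(K)\<close>.

  At the solution the derivative is built from the adjoint pair \<open>A = diag(1/a) P\<close>,
  \<open>B = diag(1/b) P\<^sup>T\<close>, as in Young's theory of successive over-relaxation. Pairing the eigenvalue equations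
  with the eigenvector shows that each eigenvalue \<open>\<zeta>\<close> satisfies \<open>(\<zeta> + \<omega> - 1)\<^sup>2 = \<omega>\<^sup>2 \<mu> \<zeta>\<close> for
  some \<open>0 \<le> \<mu> \<le> \<theta>\<^sup>2\<close>, with \<open>\<mu> = \<theta>\<^sup>2\<close> attained. For \<open>\<omega> = 1\<close> the spectral radius is therefore \<open>\<theta>\<^sup>2\<close>,
  and for \<open>1 < \<omega> < 1 + \<theta>\<^sup>2\<close> all roots are smaller in modulus. A test vector concentrated at the
  largest entry of \<open>v*\<close> (or \<open>u*\<close>) shows \<open>\<delta> \<le> \<theta>\<^sup>2\<close>.
\<close>

text \<open>The composition \<open>A \<circ> B\<close> fixes the constants, so 1 is its largest
  eigenvalue. In logarithmic coordinates the classes are vectors modulo constants, which removes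
  this eigenvalue and leaves \<theta> squared in charge. To compute with vectors, a class is
  represented by its member of weighted mean zero, with weights \<open>a\<close> on the
  \<open>u\<close> side and \<open>b\<close> on the \<open>v\<close> side. These weights are chosen
  because \<open>A\<close> carries the \<open>b\<close>-mean to the \<open>a\<close>-mean, so that
  representatives are respected.

  The derivative is not symmetric, and for \<omega> > 1 it can have nonreal eigenvalues; hence the
  pairing argument over complex vectors. The rate is a supremum of moduli, so a strict inequality
  between rates takes a bound below \<theta> squared that is uniform over all eigenvalues, and the
  existence of at least one eigenvalue.

  In \<delta>, the smallest singular value bounds \<open>K *v (v * y)\<close> from below, for all
  \<open>y\<close> because full rank makes \<open>K\<close> or its transpose injective, while the
  infinity norm bounds \<open>K *v v\<close> from above.\<close>

no_notation fps_nth (infixl \<open>$\<close> 75)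

section \<open>Symmetric operators and characteristic polynomials\<close>

text \<open>A maximizer \<open>x\<close> of the Rayleigh quotient is an eigenvector, since its
  residual \<open>f x - l x\<close> would otherwise be a direction of ascent. The bound on all of
  \<open>S\<close> is part of the conclusion because it later identifies the top eigenvalue on a
  complement and, for the negated map, the smallest singular value.\<close>

lemma symmetric_rayleigh_max:
  fixes f :: "'a::euclidean_space \<Rightarrow> 'a"
  assumes f: "linear f" and sym: "\<And>x y. f x \<bullet> y = x \<bullet> f y"
    and S: "subspace S" "f ` S \<subseteq> S" "S \<noteq> {0}"
  obtains x l where "x \<in> S" "norm x = 1" "f x = l *\<^sub>R x" "\<And>y. y \<in> S \<Longrightarrow> f y \<bullet> y \<le> l * (y \<bullet> y)"
proof -
  have "0 \<in> S" using S(1) by (rule subspace_0)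
  then obtain z where z: "z \<in> S" "z \<noteq> 0" using S(3) by blast
  have "z /\<^sub>R norm z \<in> S \<inter> sphere 0 1"
    using z S(1) by (simp add: subspace_scale)
  then have ne: "S \<inter> sphere 0 1 \<noteq> {}" by blast
  have comp: "compact (S \<inter> sphere 0 1)"
    using closed_subspace[OF S(1)] compact_sphere by (rule closed_Int_compact)
  have cont: "continuous_on (S \<inter> sphere 0 1) (\<lambda>x. f x \<bullet> x)"
    using f by (intro continuous_intros linear_continuous_on_compose[of _ _ f]) auto
  obtain x where x: "x \<in> S" "norm x = 1"
    and mx: "\<And>y. y \<in> S \<Longrightarrow> norm y = 1 \<Longrightarrow> f y \<bullet> y \<le> f x \<bullet> x"
    using continuous_attains_sup[OF comp ne cont] by (auto simp: dist_norm)
  define l where "l = f x \<bullet> x"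
  have le: "f y \<bullet> y \<le> l * (y \<bullet> y)" if "y \<in> S" for y
  proof (cases "y = 0")
    case False
    have "f (y /\<^sub>R norm y) \<bullet> (y /\<^sub>R norm y) \<le> l"
      unfolding l_def using False that S(1) by (intro mx) (auto simp: subspace_scale)
    then have "(f y \<bullet> y) / (norm y * norm y) \<le> l"
      using f by (simp add: linear_scale divide_inverse mult_ac)
    then show ?thesis
      using False by (simp add: divide_le_eq power2_eq_square dot_square_norm)
  qed (simp add: linear_0[OF f])
  have xx: "x \<bullet> x = 1" using x by (simp add: dot_square_norm)
  define w where "w = f x - l *\<^sub>R x"
  have wS: "w \<in> S" unfolding w_def using x S by (intro subspace_diff subspace_scale) auto
  \<comment> \<open>The Rayleigh bound at \<open>x + t *\<^sub>R w\<close>, after cancelling the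
    terms of order zero.\<close>
  have "2 * t * (w \<bullet> w) \<le> t\<^sup>2 * (l * (w \<bullet> w) - f w \<bullet> w)" for t
  proof -
    have fx: "f x = w + l *\<^sub>R x" by (simp add: w_def)
    have wx: "w \<bullet> x = 0" by (simp add: w_def inner_diff_left xx l_def)
    have fwx: "f w \<bullet> x = w \<bullet> w" by (simp add: sym fx inner_add_right wx)
    have "x + t *\<^sub>R w \<in> S" using x wS S(1) by (intro subspace_add subspace_scale)
    from le[OF this] show ?thesis
      using f by (simp add: linear_add linear_scale inner_add_left inner_add_right fx wx fwx xx
          inner_commute[of x w] power2_eq_square algebra_simps)
  qed
  note q = this
  have "w \<bullet> w \<le> 0"
  proof (rule ccontr)
    define c d where "c = w \<bullet> w" and "d = \<bar>l * (w \<bullet> w) - f w \<bullet> w\<bar>"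
    assume "\<not> w \<bullet> w \<le> 0"
    then have c: "c > 0" unfolding c_def by linarith
    \<comment> \<open>So small that the quadratic term cannot compensate the linear one; the summand
      1 covers \<open>d = 0\<close>.\<close>
    define t where "t = c / (d + 1)"
    have d0: "d \<ge> 0" by (simp add: d_def)
    have t: "t > 0" unfolding t_def using c d0 by (intro divide_pos_pos) auto
    have "2 * t * c \<le> t\<^sup>2 * (l * (w \<bullet> w) - f w \<bullet> w)" using q[of t] by (simp add: c_def)
    also have "\<dots> \<le> t\<^sup>2 * d" unfolding d_def by (intro mult_left_mono) auto
    finally have "2 * c \<le> t * d" using t by (simp add: power2_eq_square)
    moreover have "t * d \<le> c" unfolding t_def using c d0 by (simp add: field_simps)
    ultimately show False using c by simp
  qed
  then have "w = 0" using inner_gt_zero_iff[of w] by linarith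
  then show ?thesis using that[of x l] x le by (simp add: w_def)
qed

text \<open>Split off a Rayleigh maximizer and continue in its orthogonal complement within
  \<open>S\<close>, invariant by symmetry. A general invariant \<open>S\<close> is allowed so that
  eigenvectors fixed in advance can be completed to a basis.\<close>

lemma symmetric_spectral_theorem:
  fixes f :: "'a::euclidean_space \<Rightarrow> 'a"
  assumes f: "linear f" and sym: "\<And>x y. f x \<bullet> y = x \<bullet> f y"
    and S: "subspace S" "f ` S \<subseteq> S"
  shows "\<exists>E. pairwise orthogonal E \<and> (\<forall>v\<in>E. norm v = 1 \<and> (\<exists>l. f v = l *\<^sub>R v)) \<and> span E = S"
  using S
proof (induction "dim S" arbitrary: S rule: less_induct)
  case less
  show ?case
  proof (cases "S = {0}")
    case True
    then show ?thesis by (intro exI[of _ "{}"]) auto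
  next
    case False
    obtain x l where x: "x \<in> S" "norm x = 1" "f x = l *\<^sub>R x"
      using symmetric_rayleigh_max[OF f sym less.prems False] by blast
    define T where "T = {y \<in> S. y \<bullet> x = 0}"
    have T: "subspace T"
      using less.prems(1) unfolding T_def subspace_def by (auto simp: inner_add_left)
    have fT: "f ` T \<subseteq> T"
      using less.prems(2) x by (auto simp: T_def sym)
    have "x \<notin> T" using x(2) by (auto simp: T_def)
    moreover have "T \<subseteq> S" by (auto simp: T_def)
    ultimately have "T \<subset> S" using x(1) by blast
    then have "dim T < dim S"
      using T less.prems(1) by (intro dim_psubset) (metis span_eq_iff)
    from less.hyps[OF this T fT] obtain E where E: "pairwise orthogonal E"
      "\<And>v. v \<in> E \<Longrightarrow> norm v = 1 \<and> (\<exists>l. f v = l *\<^sub>R v)" "span E = T" by blast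
    have ET: "E \<subseteq> T" using E(3) span_superset by blast
    have "pairwise orthogonal (insert x E)"
      using E(1) ET by (auto simp: pairwise_insert T_def orthogonal_def inner_commute)
    moreover have "span (insert x E) = S"
    proof
      show "span (insert x E) \<subseteq> S"
        using ET x(1) less.prems(1) by (intro span_minimal) (auto simp: T_def)
      show "S \<subseteq> span (insert x E)"
      proof
        fix y assume y: "y \<in> S"
        have "y - (y \<bullet> x) *\<^sub>R x \<in> T"
          using y x less.prems(1)
          by (auto simp: T_def inner_diff_left dot_square_norm intro!: subspace_diff subspace_scale)
        then show "y \<in> span (insert x E)"
          unfolding span_insert using E(3) by blast
      qed
    qed
    ultimately show ?thesis using E(2) x by (intro exI[of _ "insert x E"]) auto
  qed
qed

section \<open>Characteristic polynomials of diagonalizable matrices\<close>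

lemma poly_det:
  fixes A :: "'a::comm_ring_1 poly^'n^'n"
  shows "poly (det A) t = det (\<chi> i j. poly (A $ i $ j) t)"
  by (simp add: det_def poly_sum poly_prod)

lemma poly_char_poly_mat: "poly (char_poly_mat A) t = det (mat t - A)"
  unfolding char_poly_mat_def poly_det
  by (rule arg_cong[where f = det]) (simp add: vec_eq_iff mat_def)

text \<open>Real polynomials with equal values are equal, so the computation takes place with real
  determinants, one \<open>t\<close> at a time. The hypothesis says that the columns of
  \<open>Q\<close> form a basis of eigenvectors.\<close>

lemma char_poly_mat_diagonalizable:
  fixes A Q :: "real^'m^'m"
  assumes Q: "A ** Q = Q ** diag_mat l" "det Q \<noteq> 0"
  shows "char_poly_mat A = (\<Prod>i\<in>UNIV. [:- l $ i, 1:])"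
proof (rule poly_eq_poly_eq_iff[THEN iffD1], rule ext)
  fix t
  have "mat t ** Q = Q ** mat t"
    by (simp add: vec_eq_iff matrix_matrix_mult_def mat_def if_distrib if_distribR mult.commute
        cong: if_cong)
  moreover have "(B - C) ** D = B ** D - C ** D" "D ** (B - C) = D ** B - D ** C"
    for B C D :: "real^'m^'m"
    by (simp_all add: vec_eq_iff matrix_matrix_mult_def sum_subtractf algebra_simps)
  ultimately have "(mat t - A) ** Q = Q ** (mat t - diag_mat l)"
    using Q(1) by simp
  then have "det (mat t - A) * det Q = det Q * det (mat t - diag_mat l)"
    by (metis det_mul)
  then have "det (mat t - A) = det (mat t - diag_mat l)" using Q(2) by simp
  also have "\<dots> = (\<Prod>i\<in>UNIV. t - l $ i)"
    by (subst det_diagonal) (auto simp: mat_def diag_mat_def)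
  finally show "poly (char_poly_mat A) t = poly (\<Prod>i\<in>UNIV. [:- l $ i, 1:]) t"
    by (simp add: poly_char_poly_mat poly_prod)
qed

text \<open>Ties are permitted, which accounts for multiplicities. Only the two top indices must be
  exhibited; the order among the remaining eigenvalues stays open.\<close>

lemma second_largest_eigenvalue_eq:
  fixes A Q :: "real^'m^'m"
  assumes Q: "A ** Q = Q ** diag_mat l" "det Q \<noteq> 0"
    and ij: "i \<noteq> j" "l $ j \<le> l $ i" "\<And>k. k \<noteq> i \<Longrightarrow> k \<noteq> j \<Longrightarrow> l $ k \<le> l $ j"
  shows "second_largest_eigenvalue A = l $ j"
proof -
  define R where "R = image_mset (\<lambda>k. l $ k) (mset_set (UNIV - {i, j}))"
  have "proots (char_poly_mat A) = image_mset (\<lambda>k. l $ k) (mset_set UNIV)"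
    unfolding char_poly_mat_diagonalizable[OF Q]
    by (subst proots_prod) (simp_all add: sum_unfold_sum_mset)
  also have "mset_set (UNIV :: 'm set) = {#i, j#} + mset_set (UNIV - {i, j})"
  proof -
    have "mset_set (insert i (insert j (UNIV - {i, j}))) = {#i, j#} + mset_set (UNIV - {i, j})"
      using ij(1) by simp
    moreover have "insert i (insert j (UNIV - {i, j})) = UNIV" by auto
    ultimately show ?thesis by (simp only:)
  qed
  also have "image_mset (\<lambda>k. l $ k) \<dots> = R + {#l $ j, l $ i#}"
    by (simp add: R_def)
  also have "\<dots> = mset (sorted_list_of_multiset R @ [l $ j, l $ i])" by simp
  finally have "sorted_list_of_multiset (proots (char_poly_mat A)) =
      sort (sorted_list_of_multiset R @ [l $ j, l $ i])"
    by (simp only: sorted_list_of_multiset_mset)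
  also have "\<dots> = sorted_list_of_multiset R @ [l $ j, l $ i]"
  proof (rule sorted_sort_id)
    show "sorted (sorted_list_of_multiset R @ [l $ j, l $ i])"
      using ij order_trans[OF ij(3) ij(2)] by (auto simp: sorted_append R_def)
  qed
  finally show ?thesis by (simp add: second_largest_eigenvalue_def)
qed


section \<open>Logarithmic coordinates\<close>

text \<open>The linear quotient map whose kernel consists of the constant vectors. Under it the
  Hilbert norm is the oscillation, the largest minus the smallest entry.\<close>

definition log_class :: "real^'m \<Rightarrow> 'm compositional" where
  "log_class x = ray_class (\<chi> i. exp (x $ i))"

lemma positive_vec_exp: "positive_vec (\<chi> i. exp (x $ i))"
  by (simp add: positive_vec_def)

lemma log_class_ln: "positive_vec u \<Longrightarrow> log_class (\<chi> i. ln (u $ i)) = ray_class u"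
  by (simp add: log_class_def positive_vec_def)

lemma log_class_eq_iff: "log_class x = log_class y \<longleftrightarrow> (\<exists>c. \<forall>i. x $ i = c + y $ i)"
proof -
  have refl: "ray_rel (\<chi> i. exp (z $ i)) (\<chi> i. exp (z $ i))" for z :: "real^'m"
    by (intro ray_rel_refl positive_vec_exp)
  have "log_class x = log_class y \<longleftrightarrow> ray_rel (\<chi> i. exp (x $ i)) (\<chi> i. exp (y $ i))"
    unfolding log_class_def ray_class_def
    using Quotient3_rel[OF Quotient3_compositional] refl by metis
  then show ?thesis by (simp add: ray_rel_iff positive_vec_exp)
qed

lemma log_class_surj: obtains x where "X = log_class x"
  using log_class_ln[OF rep_compositional_positive, of X] by (metis ray_class_rep)

lemma log_class_add: "log_class (x + y) = log_class x + log_class y"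
proof -
  have "(\<chi> i. exp ((x + y) $ i)) = (\<chi> i. exp (x $ i)) * (\<chi> i. exp (y $ i))"
    by (simp add: vec_eq_iff exp_add)
  then show ?thesis
    by (simp add: log_class_def ray_class_plus[OF positive_vec_exp positive_vec_exp])
qed

lemma log_class_scaleR: "log_class (r *\<^sub>R x) = r *\<^sub>R log_class x"
proof -
  have "(\<chi> i. exp ((r *\<^sub>R x) $ i)) = vec_powr (\<chi> i. exp (x $ i)) r"
    by (simp add: vec_eq_iff vec_powr_def powr_def)
  then show ?thesis
    by (simp add: log_class_def ray_class_scaleR[OF positive_vec_exp])
qed

lemma norm_log_class_upper: "x $ i - x $ j \<le> norm (log_class x)"
  using hilbert_norm_upper[OF positive_vec_exp, of x i j]
  by (simp add: log_class_def norm_ray_class[OF positive_vec_exp] hilbert_norm_def)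

lemma norm_log_class_attained: "\<exists>i j. norm (log_class x) = x $ i - x $ j"
  using hilbert_norm_attained[OF positive_vec_exp, of x]
  by (simp add: log_class_def norm_ray_class[OF positive_vec_exp] hilbert_norm_def)

lemma bounded_linear_log_class: "bounded_linear log_class"
proof (rule bounded_linear_intro[where K = 2])
  fix x :: "real^'m"
  obtain i j where "norm (log_class x) = x $ i - x $ j" using norm_log_class_attained by blast
  then show "norm (log_class x) \<le> norm x * 2"
    using component_le_norm_cart[of x i] component_le_norm_cart[of x j] by linarith
qed (auto simp: log_class_add log_class_scaleR)

text \<open>
  The linear section of \<^const>\<open>log_class\<close> that selects the logarithmic representative with
  vanishing \<open>w\<close>-weighted mean.
\<close>

definition centered_log :: "real^'m \<Rightarrow> 'm compositional \<Rightarrow> real^'m" where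
  "centered_log w X =
     (\<chi> i. ln (rep_compositional X $ i) - (\<Sum>k\<in>UNIV. w $ k * ln (rep_compositional X $ k)))"

lemma log_class_centered_log [simp]: "log_class (centered_log w X) = X"
proof -
  have "log_class (centered_log w X) = log_class (\<chi> i. ln (rep_compositional X $ i))"
    unfolding log_class_eq_iff centered_log_def
    by (rule exI[of _ "- (\<Sum>k\<in>UNIV. w $ k * ln (rep_compositional X $ k))"]) simp
  then show ?thesis by (simp add: log_class_ln rep_compositional_positive ray_class_rep)
qed

lemma centered_log_mean:
  assumes "probability_vec w"
  shows "(\<Sum>k\<in>UNIV. w $ k * centered_log w X $ k) = 0"
  using assms
  by (simp add: centered_log_def probability_vec_def right_diff_distrib sum_subtractf
      flip: sum_distrib_right)

lemma centered_log_log_class: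
  assumes w: "probability_vec w"
  shows "centered_log w (log_class x) = (\<chi> i. x $ i - (\<Sum>k\<in>UNIV. w $ k * x $ k))"
proof -
  define y where "y = centered_log w (log_class x)"
  have "log_class y = log_class x" by (simp add: y_def)
  then obtain c where c: "\<And>i. y $ i = c + x $ i" by (auto simp: log_class_eq_iff)
  have "(\<Sum>k\<in>UNIV. w $ k * y $ k) = 0" using centered_log_mean[OF w] by (simp add: y_def)
  then have "c + (\<Sum>k\<in>UNIV. w $ k * x $ k) = 0"
    using w by (simp add: c probability_vec_def distrib_left sum.distrib flip: sum_distrib_right)
  then have "c = - (\<Sum>k\<in>UNIV. w $ k * x $ k)" by linarith
  then show ?thesis unfolding y_def[symmetric] by (simp add: vec_eq_iff c)
qed

lemma centered_log_log_class_id: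
  assumes "probability_vec w" "(\<Sum>k\<in>UNIV. w $ k * x $ k) = 0"
  shows "centered_log w (log_class x) = x"
  using assms by (simp add: centered_log_log_class vec_eq_iff)

text \<open>When the \<open>w\<close>-mean of \<open>z\<close> is zero, each entry
  \<open>z $ i\<close> is a \<open>w\<close>-average of the differences
  \<open>z $ i - z $ k\<close>, hence bounded by the oscillation.\<close>

lemma bounded_linear_centered_log:
  fixes w :: "real^'m"
  assumes w: "probability_vec w"
  shows "bounded_linear (centered_log w)"
proof (rule bounded_linear_intro[where K = "CARD('m)"])
  fix X Y :: "'m compositional" and r :: real
  obtain x y where X: "X = log_class x" and Y: "Y = log_class y" by (meson log_class_surj)
  show "centered_log w (X + Y) = centered_log w X + centered_log w Y"
    unfolding X Y log_class_add[symmetric] centered_log_log_class[OF w]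
    by (simp add: vec_eq_iff distrib_left sum.distrib)
  show "centered_log w (r *\<^sub>R X) = r *\<^sub>R centered_log w X"
    unfolding X log_class_scaleR[symmetric] centered_log_log_class[OF w]
    by (simp add: vec_eq_iff right_diff_distrib sum_distrib_left mult_ac)
  define z where "z = centered_log w X"
  have "\<bar>z $ i\<bar> \<le> norm X" for i
  proof -
    have s: "(\<Sum>k\<in>UNIV. w $ k * (z $ k + s * norm X - z $ i)) = s * norm X - z $ i" for s
      using w centered_log_mean[OF w, of X]
      by (simp add: z_def probability_vec_def distrib_left right_diff_distrib sum.distrib
          sum_subtractf flip: sum_distrib_right)
    have b: "z $ k - z $ l \<le> norm X" for k l
      using norm_log_class_upper[of z k l] by (simp add: z_def)
    have "0 \<le> (\<Sum>k\<in>UNIV. w $ k * (z $ k + 1 * norm X - z $ i))"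
      using w b[of i] by (intro sum_nonneg mult_nonneg_nonneg) (auto simp: probability_vec_def algebra_simps)
    moreover have "0 \<ge> (\<Sum>k\<in>UNIV. w $ k * (z $ k + (-1) * norm X - z $ i))"
      using w b[of _ i] by (intro sum_nonpos mult_nonneg_nonpos) (auto simp: probability_vec_def algebra_simps)
    ultimately show ?thesis unfolding s by linarith
  qed
  then have "norm z \<le> (\<Sum>i\<in>(UNIV :: 'm set). norm X)"
    by (intro order_trans[OF norm_le_l1_cart] sum_mono) auto
  then show "norm (centered_log w X) \<le> norm X * CARD('m)" by (simp add: z_def mult.commute)
qed

definition log_mat :: "real^'n^'m \<Rightarrow> real^'n \<Rightarrow> real^'m" where
  "log_mat K x = (\<chi> i. ln (\<Sum>j\<in>UNIV. K $ i $ j * exp (x $ j)))"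

lemma mat_class_log_class:
  assumes "positive_mat K"
  shows "mat_class K (log_class x) = log_class (log_mat K x)"
proof -
  let ?e = "\<chi> j. exp (x $ j)"
  have "mat_class K (log_class x) = ray_class (K *v ?e)"
    unfolding log_class_def using assms by (simp add: mat_class_ray_class positive_vec_exp)
  also have "\<dots> = log_class (\<chi> i. ln ((K *v ?e) $ i))"
    using log_class_ln[OF positive_mat_vec[OF assms positive_vec_exp]] by simp
  finally show ?thesis by (simp add: log_mat_def matrix_vector_mult_def)
qed

text \<open>Completeness is inherited from Euclidean space through the bounded linear section
  \<open>centered_log\<close>; Banach's fixed point theorem asks for it.\<close>

lemma complete_compositional: "complete (UNIV :: 'm::finite compositional set)"
  unfolding complete_def
proof (intro allI impI)
  fix X :: "nat \<Rightarrow> 'm compositional"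
  assume "(\<forall>n. X n \<in> UNIV) \<and> Cauchy X"
  then have X: "Cauchy X" by simp
  define w :: "real^'m" where "w = (\<chi> i. 1 / CARD('m))"
  have w: "probability_vec w" by (simp add: w_def probability_vec_def)
  have "Cauchy (\<lambda>n. centered_log w (X n))"
    using bounded_linear.Cauchy[OF bounded_linear_centered_log[OF w] X] .
  then obtain l where "(\<lambda>n. centered_log w (X n)) \<longlonglongrightarrow> l"
    using Cauchy_convergent_iff convergent_def by blast
  from bounded_linear.tendsto[OF bounded_linear_log_class this]
  show "\<exists>l\<in>UNIV. X \<longlonglongrightarrow> l" by auto
qed


section \<open>Birkhoff's contraction and global convergence\<close>

lemma birkhoff_eta_upper:
  assumes "positive_mat K"
  shows "K $ i $ k * K $ j $ l \<le> birkhoff_eta K * (K $ j $ k * K $ i $ l)"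
proof -
  have "(K $ i $ k * K $ j $ l) / (K $ j $ k * K $ i $ l)
      \<in> range (\<lambda>(i, j, k, l). (K $ i $ k * K $ j $ l) / (K $ j $ k * K $ i $ l))"
    by (rule image_eqI[of _ _ "(i, j, k, l)"]) auto
  then have "(K $ i $ k * K $ j $ l) / (K $ j $ k * K $ i $ l) \<le> birkhoff_eta K"
    unfolding birkhoff_eta_def by (intro Max_ge) auto
  then show ?thesis
    using assms by (simp add: positive_mat_def divide_le_eq zero_less_mult_iff not_less less_imp_le)
qed

lemma birkhoff_eta_ge_1:
  assumes "positive_mat K"
  shows "birkhoff_eta K \<ge> 1"
proof -
  have p: "0 < K $ i $ k * K $ i $ k" for i k using assms by (simp add: positive_mat_def)
  from birkhoff_eta_upper[OF assms, of i k i k for i k] p show ?thesis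
    by (metis mult_le_cancel_right1 not_less)
qed

lemma birkhoff_eta_transpose: "birkhoff_eta (transpose K) = birkhoff_eta K"
proof -
  have "range (\<lambda>(i, j, k, l). (transpose K $ i $ k * transpose K $ j $ l) / (transpose K $ j $ k * transpose K $ i $ l))
      = range (\<lambda>(i, j, k, l). (K $ i $ k * K $ j $ l) / (K $ j $ k * K $ i $ l))" (is "?A = ?B")
  proof (intro equalityI subsetI)
    fix r assume "r \<in> ?A"
    then obtain i j k l where
      "r = (transpose K $ i $ k * transpose K $ j $ l) / (transpose K $ j $ k * transpose K $ i $ l)"
      by auto
    then show "r \<in> ?B" by (intro image_eqI[of _ _ "(k, l, i, j)"]) (auto simp: transpose_def mult_ac)
  next
    fix r assume "r \<in> ?B"
    then obtain i j k l where "r = (K $ i $ k * K $ j $ l) / (K $ j $ k * K $ i $ l)" by auto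
    then show "r \<in> ?A" by (intro image_eqI[of _ _ "(k, l, i, j)"]) (auto simp: transpose_def mult_ac)
  qed
  then show ?thesis by (simp add: birkhoff_eta_def)
qed

lemma birkhoff_ratio_transpose: "birkhoff_ratio (transpose K) = birkhoff_ratio K"
  by (simp add: birkhoff_ratio_def birkhoff_eta_transpose)

lemma birkhoff_ratio_bounds:
  assumes "positive_mat K"
  shows "0 \<le> birkhoff_ratio K" "birkhoff_ratio K < 1"
proof -
  have "0 \<le> (r - 1) / (r + 1)" "(r - 1) / (r + 1) < 1" if "r \<ge> 1" for r :: real
    using that by (simp_all add: divide_less_eq)
  from this[of "sqrt (birkhoff_eta K)"] birkhoff_eta_ge_1[OF assms]
  show "0 \<le> birkhoff_ratio K" "birkhoff_ratio K < 1"
    unfolding birkhoff_ratio_def by simp_all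
qed

text \<open>
  With \<open>\<alpha>\<close> and \<open>\<beta>\<close> the masses of \<open>{q < p}\<close>, the hypothesis bounds the odds ratio of \<open>\<alpha>\<close> and \<open>\<beta>\<close> by
  \<open>h\<^sup>2\<close>, and \<open>\<alpha> - \<beta> = x\<^sup>2 - y\<^sup>2\<close> for \<open>x = \<surd>(\<alpha>(1 - \<beta>))\<close>, \<open>y = \<surd>(\<beta>(1 - \<alpha>))\<close>, where \<open>x + y \<le> 1\<close> and \<open>x \<le> h y\<close>.
\<close>

lemma averages_contract_oscillation:
  fixes p q w :: "'n::finite \<Rightarrow> real"
  assumes p: "\<And>j. 0 \<le> p j" "sum p UNIV = 1" and q: "\<And>j. 0 \<le> q j" "sum q UNIV = 1"
    and h: "h \<ge> 1" "\<And>j l. p j * q l \<le> h\<^sup>2 * (q j * p l)"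
    and w: "\<And>j l. w j - w l \<le> D"
  shows "(\<Sum>j\<in>UNIV. (p j - q j) * w j) \<le> (h - 1) / (h + 1) * D"
proof -
  define S where "S = {j. q j < p j}"
  define \<alpha> \<beta> where "\<alpha> = sum p S" and "\<beta> = sum q S"
  have \<alpha>': "sum p (- S) = 1 - \<alpha>" and \<beta>': "sum q (- S) = 1 - \<beta>"
    using sum.subset_diff[of S UNIV p] sum.subset_diff[of S UNIV q] p(2) q(2)
    by (simp_all add: \<alpha>_def \<beta>_def Compl_eq_Diff_UNIV)
  have nn: "0 \<le> \<alpha>" "0 \<le> \<beta>" "0 \<le> 1 - \<alpha>" "0 \<le> 1 - \<beta>"
    unfolding \<alpha>'[symmetric] \<beta>'[symmetric] using p(1) q(1)
    by (auto simp: \<alpha>_def \<beta>_def intro: sum_nonneg)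
  have "\<alpha> * (1 - \<beta>) = (\<Sum>j\<in>S. \<Sum>l\<in>-S. p j * q l)"
    by (simp add: \<alpha>_def \<beta>'[symmetric] sum_product)
  also have "\<dots> \<le> (\<Sum>j\<in>S. \<Sum>l\<in>-S. h\<^sup>2 * (q j * p l))" by (intro sum_mono h)
  also have "\<dots> = h\<^sup>2 * (\<beta> * (1 - \<alpha>))"
    by (simp add: \<beta>_def \<alpha>'[symmetric] sum_product flip: sum_distrib_left)
  finally have odds: "\<alpha> * (1 - \<beta>) \<le> h\<^sup>2 * (\<beta> * (1 - \<alpha>))" .
  define x y where "x = sqrt (\<alpha> * (1 - \<beta>))" and "y = sqrt (\<beta> * (1 - \<alpha>))"
  have x: "x \<ge> 0" "x\<^sup>2 = \<alpha> * (1 - \<beta>)" and y: "y \<ge> 0" "y\<^sup>2 = \<beta> * (1 - \<alpha>)"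
    using nn by (simp_all add: x_def y_def)
  have "x \<le> sqrt (h\<^sup>2 * (\<beta> * (1 - \<alpha>)))" unfolding x_def using odds by simp
  then have xy: "x \<le> h * y" using h(1) by (simp add: y_def real_sqrt_mult)
  \<comment> \<open>By the inequality between geometric and arithmetic means; the two arithmetic
    means add up to 1.\<close>
  have "x \<le> (\<alpha> + (1 - \<beta>)) / 2" "y \<le> (\<beta> + (1 - \<alpha>)) / 2"
    unfolding x_def y_def using nn by (intro arith_geo_mean_sqrt; simp)+
  then have sum1: "x + y \<le> 1" by simp
  have "(h + 1) * (x - y) \<le> (h - 1) * (x + y)" using xy by (simp add: algebra_simps)
  then have "(h + 1) * (x - y) * (x + y) \<le> (h - 1) * (x + y) * (x + y)"
    using x(1) y(1) by (intro mult_right_mono) auto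
  also have "\<dots> \<le> (h - 1) * 1 * 1"
    using x(1) y(1) h(1) sum1 by (intro mult_mono) auto
  also have "(h + 1) * (x - y) * (x + y) = (h + 1) * (x\<^sup>2 - y\<^sup>2)"
    by (simp add: algebra_simps power2_eq_square)
  also have "x\<^sup>2 - y\<^sup>2 = \<alpha> - \<beta>" by (simp add: x(2) y(2) algebra_simps)
  finally have "(h + 1) * (\<alpha> - \<beta>) \<le> h - 1" by simp
  then have d: "\<alpha> - \<beta> \<le> (h - 1) / (h + 1)" using h(1) by (simp add: field_simps)
  define m where "m = Min (range w)"
  have "m \<in> range w" unfolding m_def by (intro Min_in) auto
  then obtain l where "m = w l" by auto
  moreover have "m \<le> w j" for j by (simp add: m_def)
  ultimately have m: "m \<le> w j" "w j - m \<le> D" for j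
    using w[of j l] by simp_all
  have D: "0 \<le> D" using w[of undefined undefined] by simp
  have "(\<Sum>j\<in>UNIV. (p j - q j) * w j) = (\<Sum>j\<in>UNIV. (p j - q j) * (w j - m))"
    using p(2) q(2) by (simp add: right_diff_distrib left_diff_distrib sum_subtractf flip: sum_distrib_right)
  also have "\<dots> \<le> (\<Sum>j\<in>UNIV. if j \<in> S then (p j - q j) * D else 0)"
    using m D by (intro sum_mono)
      (auto simp: S_def not_less mult_left_mono mult_nonpos_nonneg)
  also have "\<dots> = (\<alpha> - \<beta>) * D"
    by (simp add: \<alpha>_def \<beta>_def sum_subtractf flip: sum.inter_restrict sum_distrib_right)
  also have "\<dots> \<le> (h - 1) / (h + 1) * D" using d D by (intro mult_right_mono)
  finally show ?thesis .
qed

text \<open>Along the segment from \<open>y\<close> to \<open>x\<close>, the derivative of each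
  logarithmic row sum averages the increment \<open>x - y\<close> with the probability weights
  \<open>p i t\<close>.\<close>

lemma log_mat_contraction:
  fixes K :: "real^'n^'m"
  assumes K: "positive_mat K"
  shows "(log_mat K x $ i - log_mat K y $ i) - (log_mat K x $ k - log_mat K y $ k)
    \<le> birkhoff_ratio K * norm (log_class (x - y))"
proof -
  define d where "d = x - y"
  define E where "E = (\<lambda>i j t. K $ i $ j * exp (y $ j + t * d $ j))"
  define s where "s = (\<lambda>i t. \<Sum>j\<in>UNIV. E i j t)"
  define p where "p = (\<lambda>i t j. E i j t / s i t)"
  have E: "E i j t > 0" for i j t using K by (simp add: E_def positive_mat_def)
  have s: "s i t > 0" for i t unfolding s_def using E by (intro sum_pos) auto
  have der: "((\<lambda>t. ln (s i t)) has_real_derivative (\<Sum>j\<in>UNIV. p i t j * d $ j)) (at t)" for i t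
  proof -
    have "((\<lambda>t. ln (s i t)) has_real_derivative (\<Sum>j\<in>UNIV. E i j t * d $ j) / s i t) (at t)"
      using s[of i t] unfolding s_def E_def
      by (auto intro!: derivative_eq_intros simp: mult_ac)
    then show ?thesis by (simp add: p_def sum_divide_distrib)
  qed
  \<comment> \<open>The mean value theorem is applied to the difference of two rows, so that the
    same \<open>t\<close> serves both.\<close>
  define \<phi> where "\<phi> = (\<lambda>t. ln (s i t) - ln (s k t))"
  have "(\<phi> has_real_derivative (\<Sum>j\<in>UNIV. (p i t j - p k t j) * d $ j)) (at t)" for t
    unfolding \<phi>_def left_diff_distrib sum_subtractf by (intro DERIV_diff der)
  then obtain t where t: "\<phi> 1 - \<phi> 0 = (\<Sum>j\<in>UNIV. (p i t j - p k t j) * d $ j)"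
    using MVT2[of 0 1 \<phi> "\<lambda>t. \<Sum>j\<in>UNIV. (p i t j - p k t j) * d $ j"] by auto
  have "\<dots> \<le> (sqrt (birkhoff_eta K) - 1) / (sqrt (birkhoff_eta K) + 1) * norm (log_class d)"
  proof (rule averages_contract_oscillation)
    show "0 \<le> p i t j" "0 \<le> p k t j" for j using E s by (simp_all add: p_def less_imp_le)
    show "sum (p i t) UNIV = 1" "sum (p k t) UNIV = 1"
      using s[of i t] s[of k t] by (simp_all add: p_def s_def flip: sum_divide_distrib)
    show "1 \<le> sqrt (birkhoff_eta K)" using birkhoff_eta_ge_1[OF K] by simp
    \<comment> \<open>Scaling rows and columns leaves cross-ratios unchanged, so the weights inherit
      the bound valid for \<open>K\<close>.\<close>
    show "p i t j * p k t l \<le> (sqrt (birkhoff_eta K))\<^sup>2 * (p k t j * p i t l)" for j l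
    proof -
      define c where "c = exp (y $ j + t * d $ j) * exp (y $ l + t * d $ l) / (s i t * s k t)"
      have "c \<ge> 0" using s by (simp add: c_def less_imp_le)
      from mult_right_mono[OF birkhoff_eta_upper[OF K, of i j k l] this] show ?thesis
        using birkhoff_eta_ge_1[OF K] by (simp add: p_def E_def c_def mult_ac)
    qed
    show "d $ j - d $ l \<le> norm (log_class d)" for j l by (rule norm_log_class_upper)
  qed
  moreover have "\<phi> 1 - \<phi> 0 = (log_mat K x $ i - log_mat K x $ k) - (log_mat K y $ i - log_mat K y $ k)"
    by (simp add: \<phi>_def s_def E_def d_def log_mat_def)
  ultimately show ?thesis unfolding t[symmetric] by (simp add: birkhoff_ratio_def d_def)
qed

lemma birkhoff_contraction:
  assumes K: "positive_mat K"
  shows "norm (mat_class K X - mat_class K Y) \<le> birkhoff_ratio K * norm (X - Y)"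
proof -
  obtain x y where X: "X = log_class x" and Y: "Y = log_class y" by (meson log_class_surj)
  have diff: "log_class u - log_class v = log_class (u - v)" for u v :: "real^'k"
    by (simp add: linear_diff[OF bounded_linear.linear[OF bounded_linear_log_class]])
  obtain i k where
    "norm (log_class (log_mat K x - log_mat K y)) = (log_mat K x - log_mat K y) $ i - (log_mat K x - log_mat K y) $ k"
    using norm_log_class_attained by blast
  then show ?thesis
    using log_mat_contraction[OF K, of x i y k] unfolding X Y mat_class_log_class[OF K] diff by simp
qed

text \<open>\<open>sinkhorn_sol\<close> is defined by choice, so its properties rest on this
  existence statement.\<close>

lemma sinkhorn_solution_exists:
  fixes K :: "real^'n^'m"
  assumes K: "positive_mat K"
    and a: "probability_vec a" "positive_vec a" and b: "probability_vec b" "positive_vec b"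
  shows "\<exists>u v. sinkhorn_solution K a b u v"
proof -
  have Kt: "positive_mat (transpose K)" using K by (rule positive_mat_transpose)
  define L where "L = birkhoff_ratio K"
  have L: "0 \<le> L" "L < 1" using birkhoff_ratio_bounds[OF K] by (simp_all add: L_def)
  \<comment> \<open>One full step for \<omega> = 1, viewed on the second component alone.\<close>
  define T where "T = (\<lambda>V. ray_class b - mat_class (transpose K) (ray_class a - mat_class K V))"
  have "dist (T V) (T W) \<le> L * dist V W" for V W
  proof -
    have "dist (T V) (T W) = norm (mat_class (transpose K) (ray_class a - mat_class K W)
        - mat_class (transpose K) (ray_class a - mat_class K V))"
      by (simp add: T_def dist_norm)
    also have "\<dots> \<le> L * norm ((ray_class a - mat_class K W) - (ray_class a - mat_class K V))"
      unfolding L_def by (rule birkhoff_contraction[OF Kt, unfolded birkhoff_ratio_transpose])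
    also have "\<dots> \<le> 1 * norm (mat_class K V - mat_class K W)"
      using L by (intro mult_mono) auto
    also have "\<dots> \<le> L * dist V W"
      unfolding L_def dist_norm using birkhoff_contraction[OF K] by simp
    finally show ?thesis .
  qed
  then obtain V where V: "T V = V"
    using Banach_fix[OF complete_compositional UNIV_not_empty L subset_UNIV, of T] by auto
  define v u where "v = rep_compositional V" and "u = vec_divide a (K *v v)"
  define w where "w = vec_divide b (transpose K *v u)"
  have v: "positive_vec v" by (simp add: v_def rep_compositional_positive)
  have Kv: "positive_vec (K *v v)" using K v by (rule positive_mat_vec)
  have u: "positive_vec u" unfolding u_def using a(2) Kv by (rule positive_vec_divide)
  have Ku: "positive_vec (transpose K *v u)" using Kt u by (rule positive_mat_vec)
  have w: "positive_vec w" unfolding w_def using b(2) Ku by (rule positive_vec_divide)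
  have U: "ray_class a - mat_class K V = ray_class u"
    unfolding u_def mat_class_def v_def[symmetric] using a(2) Kv by (simp add: ray_class_minus)
  have "ray_class v = T V" using V by (simp add: v_def ray_class_rep)
  also have "\<dots> = ray_class w"
    unfolding T_def U w_def mat_class_ray_class[OF Kt u] using b(2) Ku by (simp add: ray_class_minus)
  finally obtain t where t: "t > 0" "v = t *\<^sub>R w" using ray_class_eq_iff[OF v w] by blast
  have uK: "u * (K *v v) = a"
    using Kv by (auto simp: u_def vec_eq_iff vec_divide_def positive_vec_def dest: less_imp_neq)
       (metis less_irrefl)
  have vK: "v * (transpose K *v u) = t *\<^sub>R b"
    unfolding t(2) using Ku
    by (auto simp: w_def vec_eq_iff vec_divide_def positive_vec_def) (metis less_irrefl)
  \<comment> \<open>The fixed class determines \<open>v\<close> only up to the factor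
    \<open>t\<close>. Computing the total mass by rows instead of columns gives
    \<open>t = 1\<close>, because \<open>a\<close> and \<open>b\<close> have the same mass.\<close>
  have "t = (\<Sum>j\<in>UNIV. (v * (transpose K *v u)) $ j)"
    unfolding vK using b(1) by (simp add: probability_vec_def flip: sum_distrib_left)
  also have "\<dots> = (\<Sum>j\<in>UNIV. \<Sum>i\<in>UNIV. u $ i * K $ i $ j * v $ j)"
    by (simp add: matrix_vector_mult_def transpose_def sum_distrib_left mult_ac)
  also have "\<dots> = (\<Sum>i\<in>UNIV. \<Sum>j\<in>UNIV. u $ i * K $ i $ j * v $ j)" by (rule sum.swap)
  also have "\<dots> = (\<Sum>i\<in>UNIV. (u * (K *v v)) $ i)"
    by (simp add: matrix_vector_mult_def sum_distrib_left mult_ac)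
  also have "\<dots> = 1" unfolding uK using a(1) by (simp add: probability_vec_def)
  finally show ?thesis using u v uK vK unfolding sinkhorn_solution_def by auto
qed

lemma sinkhorn_sol_solution:
  assumes "positive_mat K" "probability_vec a" "positive_vec a" "probability_vec b" "positive_vec b"
  shows "sinkhorn_solution K a b (fst (sinkhorn_sol K a b)) (snd (sinkhorn_sol K a b))"
proof -
  have "\<exists>z. case z of (u, v) \<Rightarrow> sinkhorn_solution K a b u v"
    using sinkhorn_solution_exists[OF assms] by simp
  from someI_ex[OF this] have "case sinkhorn_sol K a b of (u, v) \<Rightarrow> sinkhorn_solution K a b u v"
    unfolding sinkhorn_sol_def .
  then show ?thesis by (cases "sinkhorn_sol K a b") simp
qed

section \<open>Relaxed steps: fixed points and contraction toward the solution\<close>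

lemma vec_powr_relax_same:
  assumes "positive_vec x"
  shows "vec_powr x (1 - \<omega>) * vec_powr x \<omega> = x"
  using assms by (simp add: vec_eq_iff vec_powr_def positive_vec_def less_imp_le flip: powr_add)

text \<open>For a solution, \<open>a / (K v)\<close> is \<open>u\<close> itself, so relaxation forms
  the geometric mean of \<open>u\<close> with itself, whatever \<omega> is.\<close>

lemma sinkhorn_map_solution:
  assumes K: "positive_mat K" and ab: "positive_vec a" "positive_vec b"
    and sol: "sinkhorn_solution K a b u v"
  shows "sinkhorn_map \<omega> K a b (pair_class (u, v)) = pair_class (u, v)"
proof -
  have uv: "positive_vec u" "positive_vec v" "u * (K *v v) = a" "v * (transpose K *v u) = b"
    using sol by (simp_all add: sinkhorn_solution_def)
  have "vec_divide (x * y) y = x" if "positive_vec y" for x y :: "real^'k"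
    using that by (auto simp: vec_divide_def vec_eq_iff positive_vec_def) (metis less_irrefl)
  then have "vec_divide a (K *v v) = u" "vec_divide b (transpose K *v u) = v"
    using uv positive_mat_vec[OF K uv(2)] positive_mat_vec[OF positive_mat_transpose[OF K] uv(1)]
    by metis+
  then have "sinkhorn_step \<omega> K a b (u, v) = (u, v)"
    using uv by (simp add: sinkhorn_step_def vec_powr_relax_same)
  then show ?thesis using sinkhorn_map_pair_class[OF K ab uv(1,2)] by simp
qed

text \<open>The second update already uses the new \<open>U'\<close>. Because the factor is at most
  1, the error of \<open>U'\<close> is again at most \<open>e\<close>, and both components get the
  same factor.\<close>

lemma sinkhorn_map_contraction:
  assumes K: "positive_mat K" and \<omega>: "1 \<le> \<omega>" and s: "\<omega> - 1 + \<omega> * birkhoff_ratio K \<le> 1"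
    and fp: "sinkhorn_map \<omega> K a b (U0, V0) = (U0, V0)"
    and E: "norm (U - U0) \<le> e" "norm (V - V0) \<le> e"
    and F: "sinkhorn_map \<omega> K a b (U, V) = (U', V')"
  defines "s \<equiv> \<omega> - 1 + \<omega> * birkhoff_ratio K"
  shows "norm (U' - U0) \<le> s * e" "norm (V' - V0) \<le> s * e"
proof -
  define L where "L = birkhoff_ratio K"
  have L: "0 \<le> L" using birkhoff_ratio_bounds[OF K] by (simp add: L_def)
  have relax: "norm (((1 - \<omega>) *\<^sub>R X + Z - \<omega> *\<^sub>R Y) - ((1 - \<omega>) *\<^sub>R X0 + Z - \<omega> *\<^sub>R Y0)) \<le> (\<omega> - 1) * e1 + \<omega> * (L * e2)"
    if "norm (X - X0) \<le> e1" "norm (Y - Y0) \<le> L * e2" for X X0 Y Y0 Z :: "'k::finite compositional" and e1 e2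
  proof -
    have "norm (((1 - \<omega>) *\<^sub>R X + Z - \<omega> *\<^sub>R Y) - ((1 - \<omega>) *\<^sub>R X0 + Z - \<omega> *\<^sub>R Y0)) =
        norm ((1 - \<omega>) *\<^sub>R (X - X0) - \<omega> *\<^sub>R (Y - Y0))"
      by (simp add: algebra_simps)
    also have "\<dots> \<le> norm ((1 - \<omega>) *\<^sub>R (X - X0)) + norm (\<omega> *\<^sub>R (Y - Y0))"
      by (rule norm_triangle_ineq4)
    also have "\<dots> = (\<omega> - 1) * norm (X - X0) + \<omega> * norm (Y - Y0)" using \<omega> by simp
    also have "\<dots> \<le> (\<omega> - 1) * e1 + \<omega> * (L * e2)"
      using that \<omega> by (intro add_mono mult_left_mono) auto
    finally show ?thesis .
  qed
  have bir: "norm (mat_class K X - mat_class K Y) \<le> L * e'" if "norm (X - Y) \<le> e'" for X Y e'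
    using birkhoff_contraction[OF K, of X Y] mult_left_mono[OF that L] by (simp add: L_def)
  have bir': "norm (mat_class (transpose K) X - mat_class (transpose K) Y) \<le> L * e'"
    if "norm (X - Y) \<le> e'" for X Y e'
    using birkhoff_contraction[OF positive_mat_transpose[OF K], of X Y] mult_left_mono[OF that L]
    by (simp add: L_def birkhoff_ratio_transpose)
  have "(1 - \<omega>) *\<^sub>R U0 + \<omega> *\<^sub>R ray_class a - \<omega> *\<^sub>R mat_class K V0 = U0"
    using fp by (simp add: sinkhorn_map_def Let_def)
  with fp have U0: "U0 = (1 - \<omega>) *\<^sub>R U0 + \<omega> *\<^sub>R ray_class a - \<omega> *\<^sub>R mat_class K V0"
    and V0: "V0 = (1 - \<omega>) *\<^sub>R V0 + \<omega> *\<^sub>R ray_class b - \<omega> *\<^sub>R mat_class (transpose K) U0"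
    by (simp_all add: sinkhorn_map_def Let_def)
  have U': "U' = (1 - \<omega>) *\<^sub>R U + \<omega> *\<^sub>R ray_class a - \<omega> *\<^sub>R mat_class K V"
    and V': "V' = (1 - \<omega>) *\<^sub>R V + \<omega> *\<^sub>R ray_class b - \<omega> *\<^sub>R mat_class (transpose K) U'"
    using F by (auto simp: sinkhorn_map_def Let_def)
  have e: "0 \<le> e" using E(1) norm_ge_zero order_trans by blast
  show 1: "norm (U' - U0) \<le> s * e"
    using relax[OF E(1) bir[OF E(2)], of "\<omega> *\<^sub>R ray_class a"]
    by (simp only: U0[symmetric] U'[symmetric]) (simp add: s_def L_def algebra_simps)
  have "s * e \<le> 1 * e" using s e unfolding s_def by (intro mult_right_mono)
  then have 2: "norm (U' - U0) \<le> e" using 1 by simp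
  show "norm (V' - V0) \<le> s * e"
    using relax[OF E(2) bir'[OF 2], of "\<omega> *\<^sub>R ray_class b"]
    by (simp only: V0[symmetric] V'[symmetric]) (simp add: s_def L_def algebra_simps)
qed

lemma sinkhorn_iter_positive:
  assumes K: "positive_mat K" and ab: "positive_vec a" "positive_vec b"
    and uv: "positive_vec u" "positive_vec v"
  shows "positive_vec (fst (sinkhorn_iter \<omega> K a b (u, v) l)) \<and>
    positive_vec (snd (sinkhorn_iter \<omega> K a b (u, v) l))"
proof (induction l)
  case 0
  then show ?case using uv by (simp add: sinkhorn_iter_def)
next
  case (Suc l)
  obtain x y where xy: "sinkhorn_iter \<omega> K a b (u, v) l = (x, y)" by (meson surj_pair)
  define x' where "x' = vec_powr x (1 - \<omega>) * vec_powr (vec_divide a (K *v y)) \<omega>"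
  define y' where "y' = vec_powr y (1 - \<omega>) * vec_powr (vec_divide b (transpose K *v x')) \<omega>"
  have "sinkhorn_iter \<omega> K a b (u, v) (Suc l) = (x', y')"
    using xy unfolding x'_def y'_def by (simp add: sinkhorn_iter_def sinkhorn_step_def Let_def)
  moreover have x': "positive_vec x'"
    unfolding x'_def using Suc xy K ab
    by (intro positive_vec_mult positive_vec_powr positive_vec_divide positive_mat_vec) auto
  moreover have "positive_vec y'"
    unfolding y'_def using Suc xy positive_mat_transpose[OF K] ab x'
    by (intro positive_vec_mult positive_vec_powr positive_vec_divide positive_mat_vec) auto
  ultimately show ?case by simp
qed

lemma globally_convergent_over_relaxation:
  fixes K :: "real^'n^'m"
  assumes K: "positive_mat K"
    and a: "probability_vec a" "positive_vec a" and b: "probability_vec b" "positive_vec b"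
    and \<omega>: "1 \<le> \<omega>" "\<omega> < 2 / (1 + birkhoff_ratio K)"
  shows "globally_convergent \<omega> K a b"
  unfolding globally_convergent_def
proof (intro allI impI)
  fix u :: "real^'m" and v :: "real^'n"
  assume uv: "positive_vec u" "positive_vec v"
  define s where "s = \<omega> - 1 + \<omega> * birkhoff_ratio K"
  note L = birkhoff_ratio_bounds[OF K]
  have "0 \<le> \<omega> * birkhoff_ratio K" using \<omega> L by simp
  then have "0 \<le> s" unfolding s_def using \<omega>(1) by linarith
  \<comment> \<open>The upper bound on \<omega> says exactly that
    \<open>\<omega> * (1 + birkhoff_ratio K) < 2\<close>.\<close>
  moreover have "s < 1" using \<omega> L by (simp add: s_def field_simps)
  ultimately have s: "0 \<le> s" "s < 1" .
  define Z where "Z = (\<lambda>l. pair_class (sinkhorn_iter \<omega> K a b (u, v) l))"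
  obtain U0 V0 where fp: "pair_class (sinkhorn_sol K a b) = (U0, V0)" by (meson surj_pair)
  have fixp: "sinkhorn_map \<omega> K a b (U0, V0) = (U0, V0)"
    using sinkhorn_map_solution[OF K a(2) b(2) sinkhorn_sol_solution[OF K a b]] fp by simp
  have step: "Z (Suc l) = sinkhorn_map \<omega> K a b (Z l)" for l
    using sinkhorn_map_pair_class[OF K a(2) b(2)] sinkhorn_iter_positive[OF K a(2) b(2) uv]
    unfolding Z_def sinkhorn_iter_def by (metis funpow.simps(2) o_apply prod.collapse)
  define e where "e = max (norm (fst (Z 0) - U0)) (norm (snd (Z 0) - V0))"
  have bound: "norm (fst (Z l) - U0) \<le> s ^ l * e \<and> norm (snd (Z l) - V0) \<le> s ^ l * e" for l
  proof (induction l)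
    case (Suc l)
    show ?case
      using sinkhorn_map_contraction[OF K \<omega>(1) _ fixp, of "fst (Z l)" "s ^ l * e" "snd (Z l)"
          "fst (Z (Suc l))" "snd (Z (Suc l))"] Suc s
      by (simp add: step s_def mult.assoc)
  qed (simp add: e_def)
  have lim: "(\<lambda>l. s ^ l * e) \<longlonglongrightarrow> 0"
    using s by (intro tendsto_mult_left_zero LIMSEQ_power_zero) auto
  have "(\<lambda>l. fst (Z l) - U0) \<longlonglongrightarrow> 0" "(\<lambda>l. snd (Z l) - V0) \<longlonglongrightarrow> 0"
    using bound by (intro Lim_null_comparison[OF _ lim] always_eventually; simp)+
  then have "(\<lambda>l. (fst (Z l), snd (Z l))) \<longlonglongrightarrow> (U0, V0)"
    by (intro tendsto_Pair) (simp_all add: LIM_zero_iff)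
  then show "(\<lambda>l. pair_class (sinkhorn_iter \<omega> K a b (u, v) l)) \<longlonglongrightarrow> pair_class (sinkhorn_sol K a b)"
    by (simp add: Z_def fp)
qed


section \<open>Linearization at the solution\<close>

text \<open>If \<open>a\<close> lists the row sums of \<open>P\<close>, this is the conditional
  expectation of \<open>y\<close> given the row index, under the joint law \<open>P\<close>.\<close>

definition row_average :: "real^'n^'m \<Rightarrow> real^'m \<Rightarrow> real^'n \<Rightarrow> real^'m" where
  "row_average P a y = (\<chi> i. (\<Sum>j\<in>UNIV. P $ i $ j * y $ j) / a $ i)"

lemma linear_row_average: "linear (row_average P a)"
  by (rule linearI) (simp_all add: row_average_def vec_eq_iff distrib_left sum.distrib
      add_divide_distrib sum_distrib_left sum_divide_distrib mult_ac)

lemma log_mat_has_derivative: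
  fixes K :: "real^'n^'m"
  assumes K: "positive_mat K"
  shows "(log_mat K has_derivative
    (\<lambda>h. \<chi> i. (\<Sum>j\<in>UNIV. K $ i $ j * exp (x $ j) * h $ j) / (\<Sum>j\<in>UNIV. K $ i $ j * exp (x $ j)))) (at x)"
proof (subst has_derivative_componentwise_within, intro ballI)
  fix e :: "real^'m" assume "e \<in> Basis"
  then obtain i where e: "e = axis i 1" by (auto simp: Basis_vec_def)
  have nth: "((\<lambda>x :: real^'n. x $ j) has_derivative (\<lambda>h. h $ j)) (at x)" for j
    by (rule bounded_linear_imp_has_derivative) (rule bounded_linear_vec_nth)
  have pos: "(\<Sum>j\<in>UNIV. K $ i $ j * exp (x $ j)) > 0"
    using K by (intro sum_pos) (auto simp: positive_mat_def)
  have "((\<lambda>x. ln (\<Sum>j\<in>UNIV. K $ i $ j * exp (x $ j))) has_derivative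
      (\<lambda>h. (\<Sum>j\<in>UNIV. K $ i $ j * (exp (x $ j) * h $ j)) * inverse (\<Sum>j\<in>UNIV. K $ i $ j * exp (x $ j)))) (at x)"
    using pos by (auto intro!: derivative_eq_intros nth simp: mult_ac)
  then show "((\<lambda>x. log_mat K x \<bullet> e) has_derivative (\<lambda>h. (\<chi> i. (\<Sum>j\<in>UNIV. K $ i $ j * exp (x $ j) * h $ j)
      / (\<Sum>j\<in>UNIV. K $ i $ j * exp (x $ j))) \<bullet> e)) (at x)"
    by (simp add: e inner_axis log_mat_def divide_inverse mult_ac)
qed

text \<open>The derivative of \<open>log_mat\<close> has weights
  \<open>K $ i $ j * v $ j / (K *v v) $ i\<close>. Expanding these fractions by \<open>u $ i\<close>
  brings out the plan and its row sums.\<close>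

lemma mat_class_has_derivative:
  fixes K :: "real^'n^'m"
  assumes K: "positive_mat K" and v: "positive_vec v" and u: "positive_vec u"
    and w: "probability_vec w"
  shows "(mat_class K has_derivative
    (\<lambda>H. log_class (row_average (\<chi> i j. u $ i * K $ i $ j * v $ j) (u * (K *v v)) (centered_log w H))))
    (at (ray_class v))"
proof -
  define x where "x = (\<chi> j. ln (v $ j))"
  define D where "D = (\<lambda>h. \<chi> i. (\<Sum>j\<in>UNIV. K $ i $ j * exp (x $ j) * h $ j) / (\<Sum>j\<in>UNIV. K $ i $ j * exp (x $ j)))"
  have x: "log_class x = ray_class v" unfolding x_def by (rule log_class_ln[OF v])
  have ex: "exp (x $ j) = v $ j" for j using v by (simp add: x_def positive_vec_def)
  have "D = row_average (\<chi> i j. u $ i * K $ i $ j * v $ j) (u * (K *v v))"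
    unfolding D_def ex row_average_def using u
    by (simp add: fun_eq_iff vec_eq_iff matrix_vector_mult_def positive_vec_def mult.assoc less_imp_neq[symmetric]
        flip: sum_distrib_left)
  \<comment> \<open>Lifting classes affinely to vectors around \<open>x\<close> reduces the claim to
    the chain rule for \<open>log_mat\<close>.\<close>
  moreover have "mat_class K = (\<lambda>Y. log_class (log_mat K (x + centered_log w (Y - log_class x))))"
  proof
    fix Y
    have "log_class (x + centered_log w (Y - log_class x)) = Y"
      by (simp add: log_class_add)
    then show "mat_class K Y = log_class (log_mat K (x + centered_log w (Y - log_class x)))"
      by (simp flip: mat_class_log_class[OF K])
  qed
  moreover have "((\<lambda>Y. log_class (log_mat K (x + centered_log w (Y - log_class x)))) has_derivative
      (\<lambda>H. log_class (D (centered_log w H)))) (at (log_class x))"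
  proof (intro bounded_linear.has_derivative[OF bounded_linear_log_class])
    have 1: "((\<lambda>Y. x + centered_log w (Y - log_class x)) has_derivative (\<lambda>H. centered_log w H)) (at (log_class x))"
      by (auto intro!: derivative_eq_intros bounded_linear.has_derivative[OF bounded_linear_centered_log[OF w]])
    have z: "centered_log w 0 = 0"
      using bounded_linear.linear[OF bounded_linear_centered_log[OF w]] by (rule linear_0)
    have 2: "(log_mat K has_derivative D) (at (x + centered_log w (log_class x - log_class x)))"
      using log_mat_has_derivative[OF K, of x] by (simp add: z D_def)
    show "((\<lambda>Y. log_mat K (x + centered_log w (Y - log_class x))) has_derivative
      (\<lambda>H. D (centered_log w H))) (at (log_class x))"
      by (rule has_derivative_compose[OF 1 2])
  qed
  ultimately show ?thesis by (simp add: x)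
qed

text \<open>A joint law with positive entries and marginals \<open>a\<close>, \<open>b\<close>, as
  the Sinkhorn plan is. Its transpose is again one, so every fact about \<open>A\<close> also holds
  for \<open>B\<close> with \<open>a\<close> and \<open>b\<close> exchanged.\<close>

locale coupling =
  fixes P :: "real^'n^'m" and a :: "real^'m" and b :: "real^'n"
  assumes P: "0 < P $ i $ j"
    and row_sum: "(\<Sum>j\<in>UNIV. P $ i $ j) = a $ i"
    and col_sum: "(\<Sum>i\<in>UNIV. P $ i $ j) = b $ j"
    and prob_a: "probability_vec a"
begin

lemma a_pos: "0 < a $ i"
  unfolding row_sum[symmetric] using P by (intro sum_pos) auto

lemma b_pos: "0 < b $ j"
  unfolding col_sum[symmetric] using P by (intro sum_pos) auto

lemma sum_a: "(\<Sum>i\<in>UNIV. a $ i) = 1"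
  using prob_a by (simp add: probability_vec_def)

lemma sum_b: "(\<Sum>j\<in>UNIV. b $ j) = 1"
  unfolding col_sum[symmetric] by (subst sum.swap) (simp add: row_sum sum_a)

lemma prob_b: "probability_vec b"
  using sum_b b_pos by (simp add: probability_vec_def less_imp_le)

lemma transpose_coupling: "coupling (transpose P) b a"
  by standard (simp_all add: P row_sum col_sum prob_b transpose_def)

abbreviation "A \<equiv> row_average P a"
abbreviation "B \<equiv> row_average (transpose P) b"

lemma A_nth: "a $ i * A y $ i = (\<Sum>j\<in>UNIV. P $ i $ j * y $ j)"
  using a_pos[of i] by (simp add: row_average_def)

lemma A_one: "A (\<chi> j. c) = (\<chi> i. c)"
  using a_pos by (simp add: row_average_def vec_eq_iff row_sum less_imp_neq[symmetric] flip: sum_distrib_right)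

text \<open>Both sides are the bilinear form of \<open>P\<close>: \<open>A\<close> and
  \<open>B\<close> are adjoint for the inner products weighted by \<open>a\<close> and
  \<open>b\<close>.\<close>

lemma B_adjoint: "(\<Sum>i\<in>UNIV. a $ i * (A y $ i * x $ i)) = (\<Sum>j\<in>UNIV. b $ j * (B x $ j * y $ j))"
proof -
  interpret T: coupling "transpose P" b a by (rule transpose_coupling)
  have "(\<Sum>i\<in>UNIV. a $ i * (A y $ i * x $ i)) = (\<Sum>i\<in>UNIV. \<Sum>j\<in>UNIV. P $ i $ j * y $ j * x $ i)"
    by (simp add: mult.assoc[symmetric] A_nth sum_distrib_right)
  also have "\<dots> = (\<Sum>j\<in>UNIV. \<Sum>i\<in>UNIV. P $ i $ j * y $ j * x $ i)" by (rule sum.swap)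
  also have "\<dots> = (\<Sum>j\<in>UNIV. b $ j * (B x $ j * y $ j))"
    by (simp add: mult.assoc[symmetric] T.A_nth sum_distrib_right) (simp add: transpose_def mult_ac)
  finally show ?thesis .
qed

text \<open>Adjointness tested against the constant 1. Centered vectors therefore stay centered
  under \<open>A\<close>.\<close>

lemma A_mean: "(\<Sum>i\<in>UNIV. a $ i * A y $ i) = (\<Sum>j\<in>UNIV. b $ j * y $ j)"
proof -
  interpret T: coupling "transpose P" b a by (rule transpose_coupling)
  show ?thesis using B_adjoint[of y "\<chi> i. 1"] by (simp add: T.A_one)
qed

text \<open>The derivative of the relaxed Sinkhorn map at its fixed point, where \<open>P\<close> is the plan.\<close>

definition relaxed_derivative :: "real \<Rightarrow> 'm compositional \<times> 'n compositional \<Rightarrow> 'm compositional \<times> 'n compositional" where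
  "relaxed_derivative \<omega> = (\<lambda>(H, G).
     let H' = (1 - \<omega>) *\<^sub>R H - \<omega> *\<^sub>R log_class (A (centered_log b G));
         G' = (1 - \<omega>) *\<^sub>R G - \<omega> *\<^sub>R log_class (B (centered_log a H'))
     in (H', G'))"

end

section \<open>The plan and the derivative at the solution\<close>

lemma sinkhorn_plan_nth:
  "sinkhorn_plan K a b = (\<chi> i j. fst (sinkhorn_sol K a b) $ i * K $ i $ j * snd (sinkhorn_sol K a b) $ j)"
  by (simp add: sinkhorn_plan_def case_prod_beta vec_eq_iff matrix_matrix_mult_def diag_mat_def
      if_distrib[where f = "\<lambda>x. x * _"] if_distrib[where f = "\<lambda>x. _ * x"] cong: if_cong)

lemma sinkhorn_plan_coupling:
  fixes K :: "real^'n^'m"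
  assumes K: "positive_mat K"
    and a: "probability_vec a" "positive_vec a" and b: "probability_vec b" "positive_vec b"
  shows "coupling (sinkhorn_plan K a b) a b"
proof -
  obtain u v where uv: "sinkhorn_sol K a b = (u, v)" by (meson surj_pair)
  then have sol: "positive_vec u" "positive_vec v" "u * (K *v v) = a" "v * (transpose K *v u) = b"
    using sinkhorn_sol_solution[OF K a b] by (simp_all add: sinkhorn_solution_def)
  have "(\<Sum>j\<in>UNIV. u $ i * K $ i $ j * v $ j) = a $ i" for i
    unfolding sol(3)[symmetric] by (simp add: matrix_vector_mult_def sum_distrib_left mult_ac)
  moreover have "(\<Sum>i\<in>UNIV. u $ i * K $ i $ j * v $ j) = b $ j" for j
    unfolding sol(4)[symmetric] by (simp add: matrix_vector_mult_def transpose_def sum_distrib_left mult_ac)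
  ultimately show ?thesis
    using sol(1,2) K a(1)
    by unfold_locales (simp_all add: sinkhorn_plan_nth uv positive_vec_def positive_mat_def)
qed

lemma local_rate_eq:
  fixes K :: "real^'n^'m"
  assumes K: "positive_mat K"
    and a: "probability_vec a" "positive_vec a" and b: "probability_vec b" "positive_vec b"
  shows "local_rate \<omega> K a b = spectral_radius (coupling.relaxed_derivative (sinkhorn_plan K a b) a b \<omega>)"
proof -
  interpret coupling "sinkhorn_plan K a b" a b by (rule sinkhorn_plan_coupling[OF K a b])
  obtain u v where uv: "sinkhorn_sol K a b = (u, v)" by (meson surj_pair)
  then have sol: "positive_vec u" "positive_vec v" "u * (K *v v) = a" "v * (transpose K *v u) = b"
    and "sinkhorn_solution K a b u v"
    using sinkhorn_sol_solution[OF K a b] by (simp_all add: sinkhorn_solution_def)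
  then have "sinkhorn_map \<omega> K a b (ray_class u, ray_class v) = (ray_class u, ray_class v)"
    using sinkhorn_map_solution[OF K a(2) b(2)] by (simp add: pair_class_def)
  then have fp: "(1 - \<omega>) *\<^sub>R ray_class u + \<omega> *\<^sub>R ray_class a - \<omega> *\<^sub>R mat_class K (ray_class v) = ray_class u"
    by (simp add: sinkhorn_map_def Let_def)
  have P: "sinkhorn_plan K a b = (\<chi> i j. u $ i * K $ i $ j * v $ j)"
    by (simp add: sinkhorn_plan_nth uv)
  have Pt: "transpose (sinkhorn_plan K a b) = (\<chi> j i. v $ j * transpose K $ j $ i * u $ i)"
    by (simp add: P transpose_def vec_eq_iff mult_ac)
  have dA: "(mat_class K has_derivative (\<lambda>H. log_class (A (centered_log b H)))) (at (ray_class v))"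
    using mat_class_has_derivative[OF K sol(2,1) b(1)] unfolding sol(3) P .
  have dB: "(mat_class (transpose K) has_derivative (\<lambda>H. log_class (B (centered_log a H)))) (at (ray_class u))"
    using mat_class_has_derivative[OF positive_mat_transpose[OF K] sol(1,2) a(1)] unfolding sol(4) Pt .
  let ?z = "(ray_class u, ray_class v)"
  let ?U = "\<lambda>z. (1 - \<omega>) *\<^sub>R fst z + \<omega> *\<^sub>R ray_class a - \<omega> *\<^sub>R mat_class K (snd z)"
  let ?DU = "\<lambda>h. (1 - \<omega>) *\<^sub>R fst h - \<omega> *\<^sub>R log_class (A (centered_log b (snd h)))"
  have 1: "((\<lambda>z. mat_class K (snd z)) has_derivative (\<lambda>h. log_class (A (centered_log b (snd h))))) (at ?z)"
    by (rule has_derivative_compose[OF has_derivative_snd[OF has_derivative_ident]]) (simp add: dA)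
  have U: "(?U has_derivative ?DU) (at ?z)"
    by (auto intro!: derivative_eq_intros 1)
  \<comment> \<open>By the fixed point equation \<open>fp\<close>, the inner map sends
    \<open>?z\<close> to \<open>ray_class u\<close>, the point where \<open>dB\<close>
    holds.\<close>
  have 2: "((\<lambda>z. mat_class (transpose K) (?U z)) has_derivative (\<lambda>h. log_class (B (centered_log a (?DU h))))) (at ?z)"
    by (rule has_derivative_compose[OF U]) (simp add: dB fp)
  have "((\<lambda>z. (?U z, (1 - \<omega>) *\<^sub>R snd z + \<omega> *\<^sub>R ray_class b - \<omega> *\<^sub>R mat_class (transpose K) (?U z))) has_derivative
      (\<lambda>h. (?DU h, (1 - \<omega>) *\<^sub>R snd h - \<omega> *\<^sub>R log_class (B (centered_log a (?DU h)))))) (at ?z)"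
    by (intro has_derivative_Pair U) (auto intro!: derivative_eq_intros 2)
  then have "(sinkhorn_map \<omega> K a b has_derivative relaxed_derivative \<omega>) (at ?z)"
    by (simp add: sinkhorn_map_def relaxed_derivative_def Let_def case_prod_beta')
  from frechet_derivative_at[OF this] show ?thesis
    by (simp add: local_rate_def uv pair_class_def)
qed


section \<open>The spectral radius under over-relaxation\<close>

text \<open>Nonreal roots have modulus \<open>\<omega> - 1\<close>, and a negative root must be
  \<open>1 - \<omega>\<close> because the left side is a square. A root \<open>s\<^sup>2\<close>
  with \<open>s \<ge> 0\<close> satisfies
  \<open>s\<^sup>2 - \<omega> * t * s + (\<omega> - 1) \<le> 0\<close> for
  \<open>t = sqrt q\<close>, whereas this quadratic is positive at \<open>t\<close>, beyond its
  vertex. The bound \<open>r\<close> is common to all roots because a supremum over them is to be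
  taken.\<close>

lemma quadratic_root_norm_bound:
  fixes q \<omega> :: real
  assumes q: "0 < q" "q < 1" and \<omega>: "1 < \<omega>" "\<omega> < 1 + q"
  obtains r where "r < q"
    "\<And>\<mu> \<zeta>. 0 \<le> \<mu> \<Longrightarrow> \<mu> \<le> q \<Longrightarrow> (\<zeta> + of_real (\<omega> - 1))\<^sup>2 = of_real (\<omega>\<^sup>2 * \<mu>) * \<zeta> \<Longrightarrow> cmod \<zeta> \<le> r"
proof -
  define t where "t = sqrt q"
  \<comment> \<open>The value of that quadratic at \<open>t\<close>. It forces a gap
    \<open>t - s \<ge> g / t\<close>, which explains the second entry of \<open>r\<close>.\<close>
  define g where "g = (\<omega> - 1) * (1 - q)"
  define r where "r = max (\<omega> - 1) ((max 0 (t - g / t))\<^sup>2)"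
  have t: "0 < t" "t\<^sup>2 = q" using q by (simp_all add: t_def)
  have g: "0 < g" using q \<omega> by (simp add: g_def)
  have "max 0 (t - g / t) < t" using t g by simp
  then have "(max 0 (t - g / t))\<^sup>2 < t\<^sup>2" by (intro power_strict_mono) auto
  then have "r < q" using \<omega> t(2) by (simp add: r_def)
  moreover have "cmod \<zeta> \<le> r"
    if \<mu>: "0 \<le> \<mu>" "\<mu> \<le> q" and eq: "(\<zeta> + of_real (\<omega> - 1))\<^sup>2 = of_real (\<omega>\<^sup>2 * \<mu>) * \<zeta>" for \<mu> \<zeta>
  proof -
    define c w x y where "c = \<omega>\<^sup>2 * \<mu>" and "w = \<omega> - 1" and "x = Re \<zeta>" and "y = Im \<zeta>"
    have re: "(x + w)\<^sup>2 - y\<^sup>2 = c * x" and im: "2 * (x + w) * y = c * y"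
      using eq by (simp_all add: complex_eq_iff c_def w_def x_def y_def power2_eq_square mult.assoc)
    have w: "0 < w" using \<omega> by (simp add: w_def)
    have c: "0 \<le> c" using \<mu> by (simp add: c_def)
    show ?thesis
    proof (cases "y = 0")
      case False
      then have c': "c = 2 * (x + w)" using im by simp
      have "x\<^sup>2 + y\<^sup>2 = w\<^sup>2" using re unfolding c' by (simp add: power2_eq_square algebra_simps)
      then have "cmod \<zeta> = w" using w by (simp add: cmod_def x_def y_def)
      then show ?thesis by (simp add: r_def w_def)
    next
      case True
      then have cm: "cmod \<zeta> = \<bar>x\<bar>" by (simp add: cmod_def x_def y_def)
      show ?thesis
      proof (cases "x \<ge> 0")
        case False
        then have "c * x \<le> 0" using c by (simp add: mult_nonneg_nonpos)
        then have "(x + w)\<^sup>2 \<le> 0" using re True by simp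
        then have "x = - w" by simp
        then show ?thesis using cm w by (simp add: r_def w_def)
      next
        case x: True
        define s where "s = sqrt x"
        have s: "0 \<le> s" "s\<^sup>2 = x" using x by (simp_all add: s_def)
        have "(x + w)\<^sup>2 = \<omega>\<^sup>2 * \<mu> * x" using re True by (simp add: c_def)
        also have "\<dots> \<le> \<omega>\<^sup>2 * q * x" using \<mu> x by (intro mult_mono) auto
        also have "\<dots> = (\<omega> * t * s)\<^sup>2" by (simp add: power_mult_distrib t s)
        finally have "(x + w)\<^sup>2 \<le> (\<omega> * t * s)\<^sup>2" .
        moreover have "0 \<le> \<omega> * t * s" using \<omega> t(1) s(1) by simp
        ultimately have "x + w \<le> \<omega> * t * s" by (rule power2_le_imp_le)
        then have gs: "s\<^sup>2 - \<omega> * t * s + w \<le> 0" by (simp add: s)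
        have gt: "g = t\<^sup>2 - \<omega> * t * t + w"
          by (simp add: g_def w_def t(2)[symmetric] power2_eq_square algebra_simps)
        have "\<omega> < 2" using \<omega> q by simp
        then have \<omega>t: "\<omega> * t < 2 * t" "t < \<omega> * t" using t \<omega> by simp_all
        have gd: "g \<le> (t - s) * (t + s - \<omega> * t)" using gs gt by (simp add: power2_eq_square algebra_simps)
        have "s < t"
        proof (rule ccontr)
          assume "\<not> s < t"
          then have "(t - s) * (t + s - \<omega> * t) \<le> 0" using \<omega>t by (intro mult_nonpos_nonneg) auto
          then show False using gd g by simp
        qed
        then have "(t - s) * (t + s - \<omega> * t) \<le> (t - s) * t" using \<omega>t by (intro mult_left_mono) auto
        then have "g / t \<le> t - s" using gd t by (simp add: divide_le_eq)
        then have "s \<le> max 0 (t - g / t)" by simp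
        then have "s\<^sup>2 \<le> (max 0 (t - g / t))\<^sup>2" using s by (intro power_mono) auto
        then show ?thesis using cm x s by (simp add: r_def)
      qed
    qed
  qed
  ultimately show ?thesis using that by blast
qed

context coupling
begin

lemma log_class_A_centered:
  assumes "(\<Sum>j\<in>UNIV. b $ j * y $ j) = 0"
  shows "centered_log a (log_class (A y)) = A y"
  using assms by (intro centered_log_log_class_id prob_a) (simp add: A_mean)

text \<open>Pairing with \<open>x\<close> and \<open>y\<close> gives
  \<open>\<kappa> * X = - (\<omega> * z)\<close> and
  \<open>\<kappa> * Y = - (\<omega> * \<zeta> * cnj z)\<close>. Their product shows that \<mu> is
  the squared modulus of \<open>z\<close> divided by \<open>X * Y\<close>, and Cauchy-Schwarz bounds
  it by \<open>q\<close>.\<close>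

lemma coupling_complex_eigenvalue_bound:
  fixes x :: "'m \<Rightarrow> complex" and y :: "'n \<Rightarrow> complex" and \<kappa> \<zeta> :: complex
  assumes q: "0 \<le> q" "\<And>y. (\<Sum>j\<in>UNIV. b $ j * y $ j) = 0 \<Longrightarrow>
      (\<Sum>i\<in>UNIV. a $ i * (A y $ i)\<^sup>2) \<le> q * (\<Sum>j\<in>UNIV. b $ j * (y $ j)\<^sup>2)"
    and y: "(\<Sum>j\<in>UNIV. b $ j * Re (y j)) = 0" "(\<Sum>j\<in>UNIV. b $ j * Im (y j)) = 0"
    and ne: "(\<exists>i. x i \<noteq> 0) \<or> (\<exists>j. y j \<noteq> 0)"
    and ex: "\<And>i. \<kappa> * (a $ i * x i) = - (\<omega> * (\<Sum>j\<in>UNIV. P $ i $ j * y j))"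
    and ey: "\<And>j. \<kappa> * (b $ j * y j) = - (\<omega> * \<zeta> * (\<Sum>i\<in>UNIV. P $ i $ j * x i))"
  shows "\<exists>\<mu>\<ge>0. \<mu> \<le> q \<and> \<kappa>\<^sup>2 = of_real (\<omega>\<^sup>2 * \<mu>) * \<zeta>"
proof -
  define X where "X = (\<Sum>i\<in>UNIV. a $ i * (cmod (x i))\<^sup>2)"
  define Y where "Y = (\<Sum>j\<in>UNIV. b $ j * (cmod (y j))\<^sup>2)"
  define Ay where "Ay = (\<lambda>i. (\<Sum>j\<in>UNIV. P $ i $ j * y j) / a $ i)"
  define z where "z = (\<Sum>i\<in>UNIV. \<Sum>j\<in>UNIV. P $ i $ j * y j * cnj (x i))"
  have X: "0 \<le> X" and Y: "0 \<le> Y"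
    unfolding X_def Y_def using a_pos b_pos by (simp_all add: sum_nonneg less_imp_le)
  have an: "complex_of_real (a $ i) \<noteq> 0" for i using a_pos[of i] by simp
  have z': "z = (\<Sum>i\<in>UNIV. a $ i * (Ay i * cnj (x i)))"
    using an by (simp add: z_def Ay_def sum_distrib_right)
  have kX: "\<kappa> * X = - (\<omega> * z)"
  proof -
    have "\<kappa> * X = (\<Sum>i\<in>UNIV. \<kappa> * (a $ i * x i) * cnj (x i))"
      by (simp add: X_def sum_distrib_left complex_norm_square mult_ac del: of_real_power)
    also have "\<dots> = - (\<omega> * z)"
      unfolding ex by (simp add: z_def sum_distrib_left sum_distrib_right sum_negf mult_ac)
    finally show ?thesis .
  qed
  have kY: "\<kappa> * Y = - (\<omega> * \<zeta> * cnj z)"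
  proof -
    have "\<kappa> * Y = (\<Sum>j\<in>UNIV. \<kappa> * (b $ j * y j) * cnj (y j))"
      by (simp add: Y_def sum_distrib_left complex_norm_square mult_ac del: of_real_power)
    also have "\<dots> = - (\<omega> * \<zeta> * (\<Sum>j\<in>UNIV. \<Sum>i\<in>UNIV. P $ i $ j * x i * cnj (y j)))"
      unfolding ey by (simp add: sum_distrib_left sum_distrib_right sum_negf mult_ac)
    also have "(\<Sum>j\<in>UNIV. \<Sum>i\<in>UNIV. P $ i $ j * x i * cnj (y j)) = cnj z"
      unfolding z_def by (subst sum.swap) (simp add: mult_ac)
    finally show ?thesis .
  qed
  have AyY: "(\<Sum>i\<in>UNIV. a $ i * (cmod (Ay i))\<^sup>2) \<le> q * Y"
  proof -
    define y1 y2 where "y1 = (\<chi> j. Re (y j))" and "y2 = (\<chi> j. Im (y j))"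
    have "Re (Ay i) = A y1 $ i" "Im (Ay i) = A y2 $ i" for i
      by (simp_all add: Ay_def row_average_def y1_def y2_def)
    then have "(\<Sum>i\<in>UNIV. a $ i * (cmod (Ay i))\<^sup>2) =
        (\<Sum>i\<in>UNIV. a $ i * (A y1 $ i)\<^sup>2) + (\<Sum>i\<in>UNIV. a $ i * (A y2 $ i)\<^sup>2)"
      by (simp add: cmod_power2 distrib_left sum.distrib)
    also have "\<dots> \<le> q * (\<Sum>j\<in>UNIV. b $ j * (y1 $ j)\<^sup>2) + q * (\<Sum>j\<in>UNIV. b $ j * (y2 $ j)\<^sup>2)"
      using y by (intro add_mono q) (simp_all add: y1_def y2_def)
    also have "\<dots> = q * Y"
      by (simp add: Y_def y1_def y2_def cmod_power2 distrib_left sum.distrib)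
    finally show ?thesis .
  qed
  have "(cmod z)\<^sup>2 \<le> q * Y * X"
  proof -
    have "cmod z \<le> (\<Sum>i\<in>UNIV. (sqrt (a $ i) * cmod (Ay i)) * (sqrt (a $ i) * cmod (x i)))"
      unfolding z' using a_pos
      by (intro order_trans[OF norm_sum] sum_mono)
        (simp add: norm_mult mult_ac less_imp_le flip: real_sqrt_mult)
    then have "(cmod z)\<^sup>2 \<le> (\<Sum>i\<in>UNIV. (sqrt (a $ i) * cmod (Ay i)) * (sqrt (a $ i) * cmod (x i)))\<^sup>2"
      by (intro power_mono) auto
    also have "\<dots> \<le> (\<Sum>i\<in>UNIV. (sqrt (a $ i) * cmod (Ay i))\<^sup>2) * (\<Sum>i\<in>UNIV. (sqrt (a $ i) * cmod (x i))\<^sup>2)"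
      by (rule Cauchy_Schwarz_ineq_sum)
    also have "\<dots> = (\<Sum>i\<in>UNIV. a $ i * (cmod (Ay i))\<^sup>2) * X"
      using a_pos by (simp add: X_def power_mult_distrib less_imp_le)
    also have "\<dots> \<le> q * Y * X" using AyY X by (intro mult_right_mono)
    finally show ?thesis .
  qed
  note zb = this
  show ?thesis
  proof (cases "X * Y = 0")
    \<comment> \<open>Here \<open>z = 0\<close>, and whichever of \<open>X\<close> and
      \<open>Y\<close> is positive forces \<open>\<kappa> = 0\<close>; so \<mu> = 0 will do.\<close>
    case True
    then have "(cmod z)\<^sup>2 \<le> 0" using zb by (metis mult.assoc mult.commute mult_zero_right)
    then have "z = 0" by simp
    moreover have "X > 0 \<or> Y > 0"
      using ne
    proof
      assume "\<exists>i. x i \<noteq> 0"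
      then obtain i where "x i \<noteq> 0" ..
      then have "0 < X"
        unfolding X_def by (intro sum_pos2[of _ i]) (simp_all add: a_pos less_imp_le[OF a_pos])
      then show ?thesis ..
    next
      assume "\<exists>j. y j \<noteq> 0"
      then obtain j where "y j \<noteq> 0" ..
      then have "0 < Y"
        unfolding Y_def by (intro sum_pos2[of _ j]) (simp_all add: b_pos less_imp_le[OF b_pos])
      then show ?thesis ..
    qed
    ultimately have "\<kappa> = 0" using kX kY by auto
    then show ?thesis using q(1) by (intro exI[of _ 0]) auto
  next
    case False
    then have XY: "0 < X * Y" using X Y by (simp add: less_le)
    define \<mu> where "\<mu> = (cmod z)\<^sup>2 / (X * Y)"
    have "\<kappa>\<^sup>2 * of_real (X * Y) = (\<kappa> * X) * (\<kappa> * Y)" by (simp add: power2_eq_square mult_ac)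
    also have "\<dots> = \<omega>\<^sup>2 * \<zeta> * (z * cnj z)" unfolding kX kY by (simp add: power2_eq_square mult_ac)
    also have "z * cnj z = of_real (\<mu> * (X * Y))" using False by (simp add: \<mu>_def flip: complex_norm_square)
    finally have "\<kappa>\<^sup>2 * of_real (X * Y) = (of_real (\<omega>\<^sup>2 * \<mu>) * \<zeta>) * of_real (X * Y)"
      by (simp add: mult_ac)
    moreover have "complex_of_real (X * Y) \<noteq> 0" using XY by (simp only: of_real_eq_0_iff)
    ultimately have "\<kappa>\<^sup>2 = of_real (\<omega>\<^sup>2 * \<mu>) * \<zeta>" using mult_right_cancel by blast
    moreover have "0 \<le> \<mu>" using XY by (simp add: \<mu>_def)
    moreover have "\<mu> \<le> q" using zb XY by (simp add: \<mu>_def divide_le_eq mult_ac)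
    ultimately show ?thesis by blast
  qed
qed

text \<open>On an eigenvector the updated first component is \<zeta> times the old one. This is what
  enters \<open>B\<close>, and it accounts for the factor \<zeta> in the second equation.\<close>

lemma relaxed_derivative_eigenvalue_equation:
  assumes q: "0 \<le> q" "\<And>y. (\<Sum>j\<in>UNIV. b $ j * y $ j) = 0 \<Longrightarrow>
      (\<Sum>i\<in>UNIV. a $ i * (A y $ i)\<^sup>2) \<le> q * (\<Sum>j\<in>UNIV. b $ j * (y $ j)\<^sup>2)"
    and ev: "complex_eigenvalue (relaxed_derivative \<omega>) \<zeta>"
  shows "\<exists>\<mu>\<ge>0. \<mu> \<le> q \<and> (\<zeta> + of_real (\<omega> - 1))\<^sup>2 = of_real (\<omega>\<^sup>2 * \<mu>) * \<zeta>"
proof -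
  interpret T: coupling "transpose P" b a by (rule transpose_coupling)
  obtain H1 G1 H2 G2 where ne: "(H1, G1) \<noteq> 0 \<or> (H2, G2) \<noteq> 0"
    and e1: "relaxed_derivative \<omega> (H1, G1) = Re \<zeta> *\<^sub>R (H1, G1) - Im \<zeta> *\<^sub>R (H2, G2)"
    and e2: "relaxed_derivative \<omega> (H2, G2) = Im \<zeta> *\<^sub>R (H1, G1) + Re \<zeta> *\<^sub>R (H2, G2)"
    using ev unfolding complex_eigenvalue_def by auto
  let ?ca = "centered_log a" and ?cb = "centered_log b"
  have la: "linear ?ca" and lb: "linear ?cb"
    by (intro bounded_linear.linear bounded_linear_centered_log prob_a prob_b)+
  note lina = linear_add[OF la] linear_diff[OF la] linear_scale[OF la]
  note linb = linear_add[OF lb] linear_diff[OF lb] linear_scale[OF lb]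
  define x1 x2 y1 y2 where "x1 = ?ca H1" and "x2 = ?ca H2" and "y1 = ?cb G1" and "y2 = ?cb G2"
  have cA: "?ca (log_class (A (?cb G))) = A (?cb G)" for G
    using log_class_A_centered centered_log_mean[OF prob_b] .
  have cB: "?cb (log_class (B (?ca H))) = B (?ca H)" for H
    using T.log_class_A_centered centered_log_mean[OF prob_a] by simp
  have h1: "(1 - \<omega>) *\<^sub>R H1 - \<omega> *\<^sub>R log_class (A (?cb G1)) = Re \<zeta> *\<^sub>R H1 - Im \<zeta> *\<^sub>R H2"
    and g1: "(1 - \<omega>) *\<^sub>R G1 - \<omega> *\<^sub>R log_class (B (?ca (Re \<zeta> *\<^sub>R H1 - Im \<zeta> *\<^sub>R H2))) = Re \<zeta> *\<^sub>R G1 - Im \<zeta> *\<^sub>R G2"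
    using e1 by (auto simp: relaxed_derivative_def Let_def)
  have h2: "(1 - \<omega>) *\<^sub>R H2 - \<omega> *\<^sub>R log_class (A (?cb G2)) = Im \<zeta> *\<^sub>R H1 + Re \<zeta> *\<^sub>R H2"
    and g2: "(1 - \<omega>) *\<^sub>R G2 - \<omega> *\<^sub>R log_class (B (?ca (Im \<zeta> *\<^sub>R H1 + Re \<zeta> *\<^sub>R H2))) = Im \<zeta> *\<^sub>R G1 + Re \<zeta> *\<^sub>R G2"
    using e2 by (auto simp: relaxed_derivative_def Let_def)
  have x1: "(1 - \<omega>) *\<^sub>R x1 - \<omega> *\<^sub>R A y1 = Re \<zeta> *\<^sub>R x1 - Im \<zeta> *\<^sub>R x2"
    using arg_cong[OF h1, of ?ca] unfolding x1_def x2_def y1_def lina cA .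
  have x2: "(1 - \<omega>) *\<^sub>R x2 - \<omega> *\<^sub>R A y2 = Im \<zeta> *\<^sub>R x1 + Re \<zeta> *\<^sub>R x2"
    using arg_cong[OF h2, of ?ca] unfolding x1_def x2_def y2_def lina cA .
  have y1: "(1 - \<omega>) *\<^sub>R y1 - \<omega> *\<^sub>R B (Re \<zeta> *\<^sub>R x1 - Im \<zeta> *\<^sub>R x2) = Re \<zeta> *\<^sub>R y1 - Im \<zeta> *\<^sub>R y2"
    using arg_cong[OF g1, of ?cb] unfolding linb cB unfolding x1_def x2_def y1_def y2_def lina .
  have y2: "(1 - \<omega>) *\<^sub>R y2 - \<omega> *\<^sub>R B (Im \<zeta> *\<^sub>R x1 + Re \<zeta> *\<^sub>R x2) = Im \<zeta> *\<^sub>R y1 + Re \<zeta> *\<^sub>R y2"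
    using arg_cong[OF g2, of ?cb] unfolding linb cB unfolding x1_def x2_def y1_def y2_def lina .
  define x where "x = (\<lambda>i. Complex (x1 $ i) (x2 $ i))"
  define y where "y = (\<lambda>j. Complex (y1 $ j) (y2 $ j))"
  define \<kappa> where "\<kappa> = \<zeta> + of_real (\<omega> - 1)"
  note linB = linear_add[OF linear_row_average] linear_diff[OF linear_row_average] linear_scale[OF linear_row_average]
  have ex: "\<kappa> * (a $ i * x i) = - (\<omega> * (\<Sum>j\<in>UNIV. P $ i $ j * y j))" for i
  proof -
    have c: "(1 - \<omega>) * x1 $ i - \<omega> * A y1 $ i = Re \<zeta> * x1 $ i - Im \<zeta> * x2 $ i"
      "(1 - \<omega>) * x2 $ i - \<omega> * A y2 $ i = Im \<zeta> * x1 $ i + Re \<zeta> * x2 $ i"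
      using arg_cong[OF x1, of "\<lambda>v. v $ i"] arg_cong[OF x2, of "\<lambda>v. v $ i"] by simp_all
    have "a $ i * ((1 - \<omega>) * x1 $ i) - \<omega> * (a $ i * A y1 $ i) = a $ i * (Re \<zeta> * x1 $ i - Im \<zeta> * x2 $ i)"
      "a $ i * ((1 - \<omega>) * x2 $ i) - \<omega> * (a $ i * A y2 $ i) = a $ i * (Im \<zeta> * x1 $ i + Re \<zeta> * x2 $ i)"
      unfolding c[symmetric] by (simp_all add: right_diff_distrib mult.left_commute)
    then show ?thesis
      unfolding A_nth by (simp add: complex_eq_iff \<kappa>_def x_def y_def) (simp add: algebra_simps)
  qed
  have ey: "\<kappa> * (b $ j * y j) = - (\<omega> * \<zeta> * (\<Sum>i\<in>UNIV. P $ i $ j * x i))" for j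
  proof -
    have tn: "(\<Sum>i\<in>UNIV. P $ i $ j * v $ i) = b $ j * B v $ j" for v
      unfolding T.A_nth by (simp add: transpose_def)
    have c: "(1 - \<omega>) * y1 $ j - \<omega> * (Re \<zeta> * B x1 $ j - Im \<zeta> * B x2 $ j) = Re \<zeta> * y1 $ j - Im \<zeta> * y2 $ j"
      "(1 - \<omega>) * y2 $ j - \<omega> * (Im \<zeta> * B x1 $ j + Re \<zeta> * B x2 $ j) = Im \<zeta> * y1 $ j + Re \<zeta> * y2 $ j"
      using arg_cong[OF y1, of "\<lambda>v. v $ j"] arg_cong[OF y2, of "\<lambda>v. v $ j"] by (simp_all add: linB)
    have "b $ j * ((1 - \<omega>) * y1 $ j) - \<omega> * (Re \<zeta> * (b $ j * B x1 $ j) - Im \<zeta> * (b $ j * B x2 $ j)) = b $ j * (Re \<zeta> * y1 $ j - Im \<zeta> * y2 $ j)"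
      "b $ j * ((1 - \<omega>) * y2 $ j) - \<omega> * (Im \<zeta> * (b $ j * B x1 $ j) + Re \<zeta> * (b $ j * B x2 $ j)) = b $ j * (Im \<zeta> * y1 $ j + Re \<zeta> * y2 $ j)"
      unfolding c[symmetric] by (simp_all add: right_diff_distrib distrib_left mult.left_commute)
    then show ?thesis
      unfolding tn[symmetric]
      by (simp add: complex_eq_iff \<kappa>_def x_def y_def) (simp add: algebra_simps)
  qed
  have "H1 \<noteq> 0 \<or> G1 \<noteq> 0 \<or> H2 \<noteq> 0 \<or> G2 \<noteq> 0" using ne by (auto simp: zero_prod_def)
  moreover have "H = 0" if "?ca H = 0" for H
    by (metis that log_class_centered_log linear_0[OF bounded_linear.linear[OF bounded_linear_log_class]])
  moreover have "G = 0" if "?cb G = 0" for G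
    by (metis that log_class_centered_log linear_0[OF bounded_linear.linear[OF bounded_linear_log_class]])
  ultimately have "x1 \<noteq> 0 \<or> y1 \<noteq> 0 \<or> x2 \<noteq> 0 \<or> y2 \<noteq> 0"
    unfolding x1_def x2_def y1_def y2_def by blast
  then have ne': "(\<exists>i. x i \<noteq> 0) \<or> (\<exists>j. y j \<noteq> 0)"
    by (auto simp: x_def y_def complex_eq_iff vec_eq_iff)
  have mean: "(\<Sum>j\<in>UNIV. b $ j * Re (y j)) = 0" "(\<Sum>j\<in>UNIV. b $ j * Im (y j)) = 0"
    using centered_log_mean[OF prob_b] by (simp_all add: y_def y1_def y2_def)
  show ?thesis
    using coupling_complex_eigenvalue_bound[OF q mean ne' ex ey] by (simp add: \<kappa>_def)
qed

text \<open>The classes of \<open>x\<close> and \<open>B x\<close> span an invariant plane. On it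
  the eigenvector equation is a system of two scalar equations, solvable precisely by virtue of the
  quadratic equation for \<zeta>.\<close>

lemma relaxed_derivative_eigenvalueI:
  assumes x: "(\<Sum>i\<in>UNIV. a $ i * x $ i) = 0" "x \<noteq> 0" "A (B x) = q *\<^sub>R x"
    and eq: "(\<zeta> + of_real (\<omega> - 1))\<^sup>2 = of_real (\<omega>\<^sup>2 * q) * \<zeta>"
    and \<kappa>: "\<zeta> + of_real (\<omega> - 1) \<noteq> 0"
  shows "complex_eigenvalue (relaxed_derivative \<omega>) \<zeta>"
proof -
  interpret T: coupling "transpose P" b a by (rule transpose_coupling)
  define \<kappa> where "\<kappa> = \<zeta> + of_real (\<omega> - 1)"
  \<comment> \<open>The second scalar equation solved for the coefficient of \<open>G\<close>, that
    of \<open>H\<close> being 1.\<close>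
  define c where "c = - \<omega> * \<zeta> / \<kappa>"
  have k: "\<kappa> \<noteq> 0" "\<kappa>\<^sup>2 = of_real (\<omega>\<^sup>2 * q) * \<zeta>" using \<kappa> eq by (simp_all add: \<kappa>_def)
  have "of_real \<omega> * c * of_real q = - (of_real (\<omega>\<^sup>2 * q) * \<zeta>) / \<kappa>"
    by (simp add: c_def power2_eq_square mult_ac)
  also have "\<dots> = - \<kappa>" unfolding k(2)[symmetric] using k(1) by (simp add: power2_eq_square)
  finally have c1: "of_real (1 - \<omega>) - of_real \<omega> * c * of_real q = \<zeta>" by (simp add: \<kappa>_def)
  have "\<kappa> * c = - \<omega> * \<zeta>" using k(1) by (simp add: c_def)
  then have c2: "of_real (1 - \<omega>) * c - of_real \<omega> * \<zeta> = \<zeta> * c" by (simp add: \<kappa>_def algebra_simps)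
  define H G where "H = log_class x" and "G = log_class (B x)"
  have cH: "centered_log a H = x" unfolding H_def using x(1) prob_a by (intro centered_log_log_class_id)
  have cG: "centered_log b G = B x" unfolding G_def using x(1) by (rule T.log_class_A_centered[simplified])
  have H0: "H \<noteq> 0"
    using cH x(2) linear_0[OF bounded_linear.linear[OF bounded_linear_centered_log[OF prob_a]]] by metis
  note ca = linear_scale[OF bounded_linear.linear[OF bounded_linear_centered_log[OF prob_a]]]
  note cb = linear_scale[OF bounded_linear.linear[OF bounded_linear_centered_log[OF prob_b]]]
  have D: "relaxed_derivative \<omega> (s *\<^sub>R H, t *\<^sub>R G) =
      (((1 - \<omega>) * s - \<omega> * t * q) *\<^sub>R H, ((1 - \<omega>) * t - \<omega> * ((1 - \<omega>) * s - \<omega> * t * q)) *\<^sub>R G)" for s t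
  proof -
    have 1: "log_class (A (centered_log b (t *\<^sub>R G))) = (t * q) *\<^sub>R H"
      by (simp add: cb cG linear_scale[OF linear_row_average] x(3) log_class_scaleR H_def)
    have 2: "log_class (B (centered_log a (r *\<^sub>R H))) = r *\<^sub>R G" for r
      by (simp add: ca cH linear_scale[OF linear_row_average] log_class_scaleR G_def)
    have 3: "(1 - \<omega>) *\<^sub>R s *\<^sub>R H - \<omega> *\<^sub>R (t * q) *\<^sub>R H = ((1 - \<omega>) * s - \<omega> * t * q) *\<^sub>R H"
      by (simp add: scaleR_diff_left mult.assoc)
    show ?thesis
      unfolding relaxed_derivative_def Let_def prod.case 1 3 2
      by (simp only: scaleR_scaleR scaleR_diff_left[symmetric])
  qed
  have "Re (of_real (1 - \<omega>) - of_real \<omega> * c * of_real q) = Re \<zeta>"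
    "Im (of_real (1 - \<omega>) - of_real \<omega> * c * of_real q) = Im \<zeta>"
    "Re (of_real (1 - \<omega>) * c - of_real \<omega> * \<zeta>) = Re (\<zeta> * c)"
    "Im (of_real (1 - \<omega>) * c - of_real \<omega> * \<zeta>) = Im (\<zeta> * c)"
    unfolding c1 c2 by simp_all
  then have r: "(1 - \<omega>) * 1 - \<omega> * Re c * q = Re \<zeta>" "(1 - \<omega>) * 0 - \<omega> * Im c * q = Im \<zeta>"
    "(1 - \<omega>) * Re c - \<omega> * Re \<zeta> = Re \<zeta> * Re c - Im \<zeta> * Im c"
    "(1 - \<omega>) * Im c - \<omega> * Im \<zeta> = Re \<zeta> * Im c + Im \<zeta> * Re c"
    by simp_all
  show ?thesis
    unfolding complex_eigenvalue_def
  proof (intro exI conjI)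
    \<comment> \<open>Real and imaginary part of the vector with coefficients 1 and
      \<open>c\<close>; the factors 1 and 0 are written out so that \<open>D\<close>
      applies.\<close>
    show "(1 *\<^sub>R H, Re c *\<^sub>R G) \<noteq> 0 \<or> (0 *\<^sub>R H, Im c *\<^sub>R G) \<noteq> 0"
      using H0 by (simp add: zero_prod_def)
    show "relaxed_derivative \<omega> (1 *\<^sub>R H, Re c *\<^sub>R G) =
        Re \<zeta> *\<^sub>R (1 *\<^sub>R H, Re c *\<^sub>R G) - Im \<zeta> *\<^sub>R (0 *\<^sub>R H, Im c *\<^sub>R G)"
      unfolding D r by (simp add: scaleR_diff_left)
    show "relaxed_derivative \<omega> (0 *\<^sub>R H, Im c *\<^sub>R G) =
        Im \<zeta> *\<^sub>R (1 *\<^sub>R H, Re c *\<^sub>R G) + Re \<zeta> *\<^sub>R (0 *\<^sub>R H, Im c *\<^sub>R G)"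
      unfolding D r by (simp add: scaleR_add_left add.commute)
  qed
qed

lemma spectral_radius_over_relaxation:
  assumes q: "0 < q" "q < 1" "\<And>y. (\<Sum>j\<in>UNIV. b $ j * y $ j) = 0 \<Longrightarrow>
      (\<Sum>i\<in>UNIV. a $ i * (A y $ i)\<^sup>2) \<le> q * (\<Sum>j\<in>UNIV. b $ j * (y $ j)\<^sup>2)"
    and x: "(\<Sum>i\<in>UNIV. a $ i * x $ i) = 0" "x \<noteq> 0" "A (B x) = q *\<^sub>R x"
    and \<omega>: "1 < \<omega>" "\<omega> < 1 + q"
  shows "spectral_radius (relaxed_derivative \<omega>) < spectral_radius (relaxed_derivative 1)"
proof -
  have q0: "0 \<le> q" using q by simp
  have "spectral_radius (relaxed_derivative 1) = q"
    unfolding spectral_radius_def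
  proof (rule cSup_eq_maximum)
    have "complex_eigenvalue (relaxed_derivative 1) (of_real q)"
      using q(1) by (intro relaxed_derivative_eigenvalueI[OF x]) (simp_all add: power2_eq_square)
    moreover have "cmod (of_real q) = q" using q by simp
    ultimately show "q \<in> {cmod \<mu> |\<mu>. complex_eigenvalue (relaxed_derivative 1) \<mu>}"
      by (metis (mono_tags, lifting) mem_Collect_eq)
    fix r assume "r \<in> {cmod \<mu> |\<mu>. complex_eigenvalue (relaxed_derivative 1) \<mu>}"
    then obtain \<zeta> where r: "r = cmod \<zeta>" "complex_eigenvalue (relaxed_derivative 1) \<zeta>" by blast
    obtain \<mu> where \<mu>: "0 \<le> \<mu>" "\<mu> \<le> q" "\<zeta>\<^sup>2 = of_real \<mu> * \<zeta>"
      using relaxed_derivative_eigenvalue_equation[OF q0 q(3) r(2)] by auto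
    then have "\<zeta> = 0 \<or> \<zeta> = of_real \<mu>" by (auto simp: power2_eq_square)
    then show "r \<le> q" using r(1) \<mu> q0 by auto
  qed
  moreover obtain r where r: "r < q" "\<And>\<mu> \<zeta>. 0 \<le> \<mu> \<Longrightarrow> \<mu> \<le> q \<Longrightarrow>
      (\<zeta> + of_real (\<omega> - 1))\<^sup>2 = of_real (\<omega>\<^sup>2 * \<mu>) * \<zeta> \<Longrightarrow> cmod \<zeta> \<le> r"
    using quadratic_root_norm_bound[OF q(1,2) \<omega>] by blast
  have "spectral_radius (relaxed_derivative \<omega>) \<le> r"
    unfolding spectral_radius_def
  proof (rule cSup_least)
    \<comment> \<open>The set of moduli must be nonempty for its supremum to be bounded by
      \<open>r\<close>. The quadratic formula for \<mu> = \<open>q\<close> supplies an eigenvalue;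
      the discriminant may be negative, hence \<open>csqrt\<close>.\<close>
    define p d where "p = complex_of_real (\<omega>\<^sup>2 * q / 2 - (\<omega> - 1))" and "d = csqrt (p\<^sup>2 - of_real ((\<omega> - 1)\<^sup>2))"
    define \<zeta> where "\<zeta> = p + d"
    have "(\<zeta> - p)\<^sup>2 = p\<^sup>2 - of_real ((\<omega> - 1)\<^sup>2)" by (simp add: \<zeta>_def d_def)
    then have "\<zeta>\<^sup>2 + of_real ((\<omega> - 1)\<^sup>2) = 2 * p * \<zeta>" by (simp add: power2_eq_square algebra_simps)
    also have "2 * p * \<zeta> = of_real (\<omega>\<^sup>2 * q) * \<zeta> - 2 * of_real (\<omega> - 1) * \<zeta>"
      by (simp add: p_def algebra_simps)
    finally have eq: "(\<zeta> + of_real (\<omega> - 1))\<^sup>2 = of_real (\<omega>\<^sup>2 * q) * \<zeta>"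
      by (simp add: power2_eq_square algebra_simps)
    have "\<zeta> + of_real (\<omega> - 1) \<noteq> 0"
    proof
      assume 0: "\<zeta> + of_real (\<omega> - 1) = 0"
      then have "of_real (\<omega>\<^sup>2 * q) * \<zeta> = 0" using eq by simp
      then have "\<zeta> = 0" using \<omega> q by auto
      then show False using 0 \<omega> by (simp add: complex_eq_iff)
    qed
    then have "complex_eigenvalue (relaxed_derivative \<omega>) \<zeta>"
      by (intro relaxed_derivative_eigenvalueI[OF x eq])
    then show "{cmod \<mu> |\<mu>. complex_eigenvalue (relaxed_derivative \<omega>) \<mu>} \<noteq> {}" by blast
  next
    fix s assume "s \<in> {cmod \<mu> |\<mu>. complex_eigenvalue (relaxed_derivative \<omega>) \<mu>}"
    then obtain \<zeta> where s: "s = cmod \<zeta>" "complex_eigenvalue (relaxed_derivative \<omega>) \<zeta>" by blast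
    show "s \<le> r"
      using relaxed_derivative_eigenvalue_equation[OF q0 q(3) s(2)] r(2) s(1) by auto
  qed
  ultimately show ?thesis using r(1) by simp
qed

end


section \<open>The second largest eigenvalue\<close>

context coupling
begin

lemma A_B_symmetric:
  "(\<Sum>i\<in>UNIV. a $ i * (A (B x) $ i * x' $ i)) = (\<Sum>j\<in>UNIV. b $ j * (B x $ j * B x' $ j))"
  unfolding B_adjoint by (simp add: mult.commute)

text \<open>An operator and its adjoint have the same norm: the squared norm \<open>N\<close> of
  \<open>A y\<close> is the pairing of \<open>B (A y)\<close> with \<open>y\<close>, so
  Cauchy-Schwarz gives \<open>N\<^sup>2 \<le> q * N * Y\<close>.\<close>

lemma dual_quadratic_bound:
  assumes q: "0 \<le> q" "\<And>x. (\<Sum>i\<in>UNIV. a $ i * x $ i) = 0 \<Longrightarrow>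
      (\<Sum>j\<in>UNIV. b $ j * (B x $ j)\<^sup>2) \<le> q * (\<Sum>i\<in>UNIV. a $ i * (x $ i)\<^sup>2)"
    and y: "(\<Sum>j\<in>UNIV. b $ j * y $ j) = 0"
  shows "(\<Sum>i\<in>UNIV. a $ i * (A y $ i)\<^sup>2) \<le> q * (\<Sum>j\<in>UNIV. b $ j * (y $ j)\<^sup>2)"
proof -
  define N where "N = (\<Sum>i\<in>UNIV. a $ i * (A y $ i)\<^sup>2)"
  define Y where "Y = (\<Sum>j\<in>UNIV. b $ j * (y $ j)\<^sup>2)"
  have N: "0 \<le> N" and Y: "0 \<le> Y"
    unfolding N_def Y_def using a_pos b_pos by (simp_all add: sum_nonneg less_imp_le)
  have "N = (\<Sum>j\<in>UNIV. (sqrt (b $ j) * B (A y) $ j) * (sqrt (b $ j) * y $ j))"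
    using b_pos by (simp add: N_def power2_eq_square B_adjoint less_imp_le mult_ac
        flip: mult.assoc[of "sqrt (b $ j)" "sqrt (b $ j)" for j])
  then have "N\<^sup>2 \<le> (\<Sum>j\<in>UNIV. (sqrt (b $ j) * B (A y) $ j)\<^sup>2) * (\<Sum>j\<in>UNIV. (sqrt (b $ j) * y $ j)\<^sup>2)"
    using Cauchy_Schwarz_ineq_sum by metis
  also have "\<dots> = (\<Sum>j\<in>UNIV. b $ j * (B (A y) $ j)\<^sup>2) * Y"
    using b_pos by (simp add: Y_def power_mult_distrib less_imp_le)
  also have "\<dots> \<le> q * N * Y"
    unfolding N_def using y by (intro mult_right_mono q Y) (simp add: A_mean)
  finally have "N * N \<le> q * Y * N" by (simp add: power2_eq_square mult_ac)
  then show ?thesis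
    using N q(1) Y unfolding N_def[symmetric] Y_def[symmetric]
    by (cases "N = 0") (auto simp: mult_le_cancel_right)
qed

text \<open>
  The symmetric form of \<open>A \<circ> B\<close>, obtained by conjugation with the diagonal matrix of square
  roots of \<open>a\<close>.
\<close>

definition symmetrized :: "real^'m \<Rightarrow> real^'m" where
  "symmetrized z = (\<chi> i. sqrt (a $ i) * A (B (\<chi> k. z $ k / sqrt (a $ k))) $ i)"

lemma sqrt_a: "sqrt (a $ i) \<noteq> 0" "sqrt (a $ i) * sqrt (a $ i) = a $ i"
  using a_pos[of i] by simp_all

lemma linear_symmetrized: "linear symmetrized"
proof -
  have "linear (\<lambda>z :: real^'m. \<chi> k. z $ k / sqrt (a $ k))"
    by (rule linearI) (simp_all add: vec_eq_iff add_divide_distrib)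
  note l = linear_compose[OF linear_compose[OF this linear_row_average[of "transpose P" b]] linear_row_average[of P a]]
  define h where "h = A \<circ> (B \<circ> (\<lambda>z :: real^'m. \<chi> k. z $ k / sqrt (a $ k)))"
  have h: "linear h" unfolding h_def by (rule l)
  have "symmetrized = (\<lambda>z. \<chi> i. sqrt (a $ i) * h z $ i)"
    by (simp add: fun_eq_iff symmetrized_def h_def)
  then show ?thesis
    by (auto intro!: linearI simp: vec_eq_iff distrib_left linear_add[OF h] linear_scale[OF h])
qed

text \<open>A Gram form, which makes the operator symmetric and positive semidefinite.\<close>

lemma symmetrized_inner:
  "symmetrized z \<bullet> y = (\<Sum>j\<in>UNIV. b $ j *
     (B (\<chi> k. z $ k / sqrt (a $ k)) $ j * B (\<chi> k. y $ k / sqrt (a $ k)) $ j))"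
proof -
  have "sqrt (a $ i) * r * y $ i = a $ i * (r * (\<chi> k. y $ k / sqrt (a $ k)) $ i)" for i r
    using sqrt_a[of i] by (simp add: field_simps)
  then show ?thesis
    unfolding A_B_symmetric[symmetric] by (simp add: inner_vec_def symmetrized_def)
qed

lemma second_largest_eigenvalue_coupling:
  assumes m: "2 \<le> CARD('m)"
  obtains q x where
    "second_largest_eigenvalue
      (diag_mat (vec_divide 1 a) ** P ** diag_mat (vec_divide 1 b) ** transpose P) = q"
    "0 \<le> q" "q < 1" "(\<Sum>i\<in>UNIV. a $ i * x $ i) = 0" "x \<noteq> 0" "A (B x) = q *\<^sub>R x"
    "\<And>x. (\<Sum>i\<in>UNIV. a $ i * x $ i) = 0 \<Longrightarrow>
      (\<Sum>j\<in>UNIV. b $ j * (B x $ j)\<^sup>2) \<le> q * (\<Sum>i\<in>UNIV. a $ i * (x $ i)\<^sup>2)"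
proof -
  interpret T: coupling "transpose P" b a by (rule transpose_coupling)
  let ?f = symmetrized
  let ?s = "\<lambda>z :: real^'m. \<chi> k. z $ k / sqrt (a $ k)"
  note lf = linear_symmetrized
  have sym: "?f z \<bullet> y = z \<bullet> ?f y" for z y
    using symmetrized_inner[of z y] symmetrized_inner[of y z]
    by (simp add: inner_commute[of z] mult.commute[of "B (?s z) $ j" for j])
  \<comment> \<open>The constant 1 in the conjugated coordinates: the unit eigenvector for
    eigenvalue 1. Orthogonality to it means \<open>a\<close>-mean zero.\<close>
  define e where "e = (\<chi> i. sqrt (a $ i))"
  have se: "?s e = (\<chi> k. 1)" using sqrt_a by (simp add: e_def)
  have ee: "e \<bullet> e = 1" using sqrt_a sum_a by (simp add: e_def inner_vec_def)
  have fe: "?f e = e"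
    unfolding symmetrized_def se by (simp add: T.A_one A_one e_def)
  have ze: "z \<bullet> e = (\<Sum>i\<in>UNIV. a $ i * ?s z $ i)" for z
  proof -
    have "z $ i * sqrt (a $ i) = a $ i * ?s z $ i" for i
      using sqrt_a[of i] by (simp add: field_simps)
    then show ?thesis by (simp add: inner_vec_def e_def)
  qed
  define T where "T = {z. z \<bullet> e = 0}"
  have T: "subspace T" "?f ` T \<subseteq> T"
    by (auto simp: T_def subspace_def inner_add_left sym fe)
  obtain i1 i2 :: 'm where i12: "i1 \<noteq> i2"
    using m card_le_Suc0_iff_eq[of "UNIV :: 'm set"] by auto
  \<comment> \<open>A nonzero vector orthogonal to \<open>e\<close>; it exists because there are two
    different indices.\<close>
  define z1 where "z1 = axis i1 (sqrt (a $ i2)) - axis i2 (sqrt (a $ i1))"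
  have "z1 \<in> T" by (simp add: T_def z1_def e_def inner_diff_left inner_axis' mult.commute)
  moreover have "z1 $ i1 \<noteq> 0" using i12 sqrt_a(1) by (simp add: z1_def axis_def)
  then have "z1 \<noteq> 0" by auto
  ultimately have T0: "T \<noteq> {0}" by blast
  obtain z0 q where z0: "z0 \<in> T" "norm z0 = 1" "?f z0 = q *\<^sub>R z0"
    and ray: "\<And>z. z \<in> T \<Longrightarrow> ?f z \<bullet> z \<le> q * (z \<bullet> z)"
    using symmetric_rayleigh_max[OF lf sym T T0] by blast
  have z0z0: "z0 \<bullet> z0 = 1" using z0(2) by (simp add: dot_square_norm)
  have eigen: "A (B (?s z)) = l *\<^sub>R ?s z" if "?f z = l *\<^sub>R z" for z l
  proof -
    have "sqrt (a $ i) * A (B (?s z)) $ i = l * z $ i" for i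
      using that by (simp add: vec_eq_iff symmetrized_def)
    then show ?thesis using sqrt_a(1) by (simp add: vec_eq_iff nonzero_eq_divide_eq mult.commute)
  qed
  define x where "x = ?s z0"
  have xm: "(\<Sum>i\<in>UNIV. a $ i * x $ i) = 0" using z0(1) ze by (simp add: T_def x_def)
  have "z0 \<noteq> 0" using z0(2) by auto
  then have x0: "x \<noteq> 0" using sqrt_a(1) by (auto simp: x_def vec_eq_iff)
  have xq: "A (B x) = q *\<^sub>R x" unfolding x_def by (rule eigen[OF z0(3)])
  have "q = ?f z0 \<bullet> z0" using z0z0 by (simp add: z0(3))
  also have "\<dots> \<ge> 0" unfolding symmetrized_inner
    using b_pos by (intro sum_nonneg) (simp add: less_imp_le)
  finally have q0: "0 \<le> q" .
  have bound: "(\<Sum>j\<in>UNIV. b $ j * (B w $ j)\<^sup>2) \<le> q * (\<Sum>i\<in>UNIV. a $ i * (w $ i)\<^sup>2)"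
    if w: "(\<Sum>i\<in>UNIV. a $ i * w $ i) = 0" for w
  proof -
    define z where "z = (\<chi> i. sqrt (a $ i) * w $ i)"
    have sz: "?s z = w" using sqrt_a by (simp add: z_def vec_eq_iff)
    have "z \<in> T" using ze[of z] w unfolding T_def sz by simp
    from ray[OF this] show ?thesis
      unfolding symmetrized_inner sz
      using a_pos by (simp add: inner_vec_def z_def power2_eq_square mult_ac less_imp_le
          flip: mult.assoc[of "sqrt (a $ i)" "sqrt (a $ i)" for i])
  qed
  \<comment> \<open>Maximum principle: \<open>x\<close> is not constant and all weights are
    positive, so averaging lowers the positive maximum \<open>M\<close> strictly.\<close>
  have q1: "q < 1"
  proof -
    define M where "M = Max (range (\<lambda>i. x $ i))"
    have "M \<in> range (\<lambda>i. x $ i)" unfolding M_def by (intro Max_in) auto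
    then obtain i where i: "M = x $ i" by blast
    have le: "x $ k \<le> M" for k by (simp add: M_def)
    have "\<exists>k. x $ k < M"
    proof (rule ccontr)
      assume "\<not> ?thesis"
      then have "x $ k = M" for k using le[of k] by (simp add: not_less order_antisym)
      then show False using xm x0 by (auto simp: vec_eq_iff sum_a simp flip: sum_distrib_right)
    qed
    then obtain k where k: "x $ k < M" ..
    have "(\<Sum>i\<in>UNIV. a $ i * x $ i) < (\<Sum>i\<in>UNIV. a $ i * M)"
      using le k a_pos by (intro sum_strict_mono_ex1) (auto simp: less_imp_le intro!: bexI[of _ k])
    then have M: "0 < M" using xm by (simp add: sum_a flip: sum_distrib_right)
    have Bx: "B x $ j < M" for j
    proof -
      have "(\<Sum>i\<in>UNIV. transpose P $ j $ i * x $ i) < (\<Sum>i\<in>UNIV. transpose P $ j $ i * M)"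
        using le k T.P by (intro sum_strict_mono_ex1) (auto simp: less_imp_le intro!: bexI[of _ k])
      also have "\<dots> = b $ j * M" by (simp add: T.row_sum flip: sum_distrib_right)
      finally show ?thesis unfolding T.A_nth[symmetric] using mult_less_cancel_left_pos[OF b_pos] by blast
    qed
    have "(\<Sum>j\<in>UNIV. P $ i $ j * B x $ j) < (\<Sum>j\<in>UNIV. P $ i $ j * M)"
      using Bx P by (intro sum_strict_mono) auto
    also have "\<dots> = a $ i * M" by (simp add: row_sum flip: sum_distrib_right)
    finally have "A (B x) $ i < M" unfolding A_nth[symmetric] using mult_less_cancel_left_pos[OF a_pos] by blast
    then show "q < 1" using M by (simp add: xq i)
  qed
  \<comment> \<open>Completing \<open>e\<close> and \<open>z0\<close> by an eigenbasis of this
    complement keeps control of where the two top eigenvalues sit.\<close>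
  define T' where "T' = {z \<in> T. z \<bullet> z0 = 0}"
  have T': "subspace T'" "?f ` T' \<subseteq> T'"
    using T by (auto simp: T'_def subspace_def inner_add_left sym z0(3))
  obtain E where E: "pairwise orthogonal E"
    "\<And>v. v \<in> E \<Longrightarrow> norm v = 1 \<and> (\<exists>l. ?f v = l *\<^sub>R v)" "span E = T'"
    using symmetric_spectral_theorem[OF lf sym T'] by blast
  have ET: "v \<bullet> e = 0" "v \<bullet> z0 = 0" "v \<in> T" if "v \<in> E" for v
    using that E(3) span_superset[of E] by (auto simp: T'_def T_def)
  have z0e: "z0 \<bullet> e = 0" using z0(1) by (simp add: T_def)
  define F where "F = insert e (insert z0 E)"
  have Fo: "pairwise orthogonal F"
    using E(1) ET z0e
    by (auto simp: F_def pairwise_insert orthogonal_def inner_commute)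
  have Fn: "norm v = 1" if "v \<in> F" for v
    using that E(2) z0(2) ee by (auto simp: F_def norm_eq_sqrt_inner)
  have "0 \<notin> F" using Fn by force
  then have ind: "independent F" using Fo by (rule pairwise_orthogonal_independent[rotated])
  have "span F = UNIV"
  proof (intro equalityI subsetI)
    fix y :: "real^'m"
    define y1 where "y1 = y - (y \<bullet> e) *\<^sub>R e"
    have "y1 - (y1 \<bullet> z0) *\<^sub>R z0 \<in> T'"
      using z0e ee z0z0 by (simp add: T'_def T_def y1_def inner_diff_left)
    then have "y1 \<in> span (insert z0 E)" unfolding span_insert E(3) by blast
    then show "y \<in> span F"
      unfolding F_def span_insert[of e] y1_def by blast
  qed auto
  then have cardF: "card F = CARD('m)" "finite F"
    using dim_eq_card_independent[OF ind] dim_span[of F] independent_imp_finite[OF ind] by simp_all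
  then obtain g :: "'m \<Rightarrow> real^'m" where g: "bij_betw g UNIV F"
    using finite_same_card_bij[of "UNIV :: 'm set" F] by auto
  have gF: "g k \<in> F" for k using g by (auto simp: bij_betw_def)
  have inj: "g k = g l \<longleftrightarrow> k = l" for k l using g by (auto simp: bij_betw_def inj_on_def)
  define l where "l = (\<chi> k. ?f (g k) \<bullet> g k)"
  have fg: "?f (g k) = l $ k *\<^sub>R g k" for k
  proof -
    have "\<exists>r. ?f (g k) = r *\<^sub>R g k"
      using gF[of k] E(2) z0(3) fe unfolding F_def by (metis insert_iff scaleR_one)
    then obtain r where r: "?f (g k) = r *\<^sub>R g k" ..
    then have "l $ k = r" using Fn[OF gF[of k]] by (simp add: l_def dot_square_norm)
    with r show ?thesis by simp
  qed
  define V :: "real^'m^'m" where "V = (\<chi> i k. g k $ i)"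
  define D :: "real^'m^'m" where "D = diag_mat (\<chi> i. 1 / sqrt (a $ i))"
  \<comment> \<open>Undoing the conjugation turns the orthonormal eigenbasis into eigenvectors of
    the matrix itself; \<open>Q = D ** V\<close> is invertible as a product of invertible
    factors.\<close>
  define Q :: "real^'m^'m" where "Q = (\<chi> i k. ?s (g k) $ i)"
  have col: "column k V = g k" for k by (simp add: V_def column_def vec_eq_iff)
  have "orthogonal_matrix V"
    unfolding orthogonal_matrix_orthonormal_columns col
    using Fn gF Fo inj by (auto simp: pairwise_def)
  then have "det V \<noteq> 0" using det_orthogonal_matrix by force
  moreover have "det D \<noteq> 0"
    unfolding D_def using sqrt_a(1) by (subst det_diagonal) (auto simp: diag_mat_def)
  moreover have "Q = D ** V"
    by (simp add: Q_def D_def V_def diag_mat_def matrix_matrix_mult_def vec_eq_iff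
        if_distrib[where f = "\<lambda>x. x * _"] cong: if_cong)
  ultimately have detQ: "det Q \<noteq> 0" by (simp add: det_mul)
  define M where "M = diag_mat (vec_divide 1 a) ** P ** diag_mat (vec_divide 1 b) ** transpose P"
  have Mx: "M *v w = A (B w)" for w
  proof -
    have d: "diag_mat c *v y = (\<chi> i. c $ i * y $ i)" for c y :: "real^'k"
      by (simp add: diag_mat_def matrix_vector_mult_def vec_eq_iff
        if_distrib[where f = "\<lambda>x. x * _"] cong: if_cong)
    show ?thesis
      unfolding M_def matrix_vector_mul_assoc[symmetric] d
      by (simp add: row_average_def vec_divide_def matrix_vector_mult_def vec_eq_iff)
  qed
  have MQ: "M ** Q = Q ** diag_mat l"
  proof -
    have "(M ** Q) $ i $ k = (Q ** diag_mat l) $ i $ k" for i k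
    proof -
      have "(M ** Q) $ i $ k = (M *v ?s (g k)) $ i"
        by (simp add: Q_def matrix_matrix_mult_def matrix_vector_mult_def)
      also have "\<dots> = l $ k * ?s (g k) $ i" unfolding Mx eigen[OF fg] by simp
      also have "\<dots> = (Q ** diag_mat l) $ i $ k"
        by (simp add: Q_def diag_mat_def matrix_matrix_mult_def
          if_distrib[where f = "\<lambda>x. _ * x"] if_distrib[where f = "\<lambda>x. x / _"] mult.commute cong: if_cong)
      finally show ?thesis .
    qed
    then show ?thesis by (simp add: vec_eq_iff)
  qed
  have "range g = F" using g by (rule bij_betw_imp_surj_on)
  then have "e \<in> range g" "z0 \<in> range g" by (simp_all add: F_def)
  then obtain i0 j0 where i0: "g i0 = e" and j0: "g j0 = z0" by (metis imageE)
  have li: "l $ i0 = 1" by (simp add: l_def i0 fe ee)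
  have lj: "l $ j0 = q" by (simp add: l_def j0 z0(3) z0z0)
  have "e \<noteq> z0" using z0e ee by auto
  then have ij: "i0 \<noteq> j0" using i0 j0 by auto
  have "second_largest_eigenvalue M = l $ j0"
  proof (rule second_largest_eigenvalue_eq[OF MQ detQ ij])
    show "l $ j0 \<le> l $ i0" using li lj q1 by simp
    fix k assume "k \<noteq> i0" "k \<noteq> j0"
    then have "g k \<noteq> e" "g k \<noteq> z0" using inj i0 j0 by metis+
    then have "g k \<in> E" using gF[of k] by (simp add: F_def)
    then show "l $ k \<le> l $ j0"
      using ray[OF ET(3), of "g k"] E(2)[of "g k"] by (simp add: l_def[THEN arg_cong[of _ _ "\<lambda>v. v $ k"]] lj dot_square_norm)
  qed
  then show ?thesis
    using that[OF _ q0 q1 xm x0 xq bound] lj by (simp add: M_def)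
qed

end


section \<open>The lower bound for the second largest eigenvalue\<close>

lemma gram_inner: "((transpose K ** K) *v x) \<bullet> y = (K *v x) \<bullet> (K *v y)"
  for K :: "real^'n^'m"
  by (simp add: dot_lmul_matrix flip: matrix_vector_mul_assoc)

text \<open>If \<open>x\<close> is a right singular vector for \<sigma> > 0, then
  \<open>K *v x\<close> is a nonzero left singular vector for the same \<sigma>.\<close>

lemma singular_value_set_transpose_subset:
  fixes K :: "real^'n^'m"
  shows "{\<sigma>. 0 < \<sigma> \<and> (\<exists>x. x \<noteq> 0 \<and> (transpose K ** K) *v x = \<sigma>\<^sup>2 *\<^sub>R x)}
    \<subseteq> {\<sigma>. 0 < \<sigma> \<and> (\<exists>x. x \<noteq> 0 \<and> (transpose (transpose K) ** transpose K) *v x = \<sigma>\<^sup>2 *\<^sub>R x)}"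
proof
  fix \<sigma> assume "\<sigma> \<in> {\<sigma>. 0 < \<sigma> \<and> (\<exists>x. x \<noteq> 0 \<and> (transpose K ** K) *v x = \<sigma>\<^sup>2 *\<^sub>R x)}"
  then obtain x where s: "0 < \<sigma>" and x: "x \<noteq> 0" "transpose K *v (K *v x) = \<sigma>\<^sup>2 *\<^sub>R x"
    by (auto simp only: mem_Collect_eq matrix_vector_mul_assoc)
  have "K *v x \<noteq> 0"
  proof
    assume "K *v x = 0"
    then have "\<sigma>\<^sup>2 *\<^sub>R x = 0" using x(2) by simp
    then show False using s x(1) by simp
  qed
  moreover have "(transpose (transpose K) ** transpose K) *v (K *v x) = \<sigma>\<^sup>2 *\<^sub>R (K *v x)"
    by (simp only: transpose_transpose matrix_vector_mul_assoc[symmetric] x(2) matrix_vector_mult_scaleR)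
  ultimately show "\<sigma> \<in> {\<sigma>. 0 < \<sigma> \<and> (\<exists>x. x \<noteq> 0 \<and> (transpose (transpose K) ** transpose K) *v x = \<sigma>\<^sup>2 *\<^sub>R x)}"
    using s by blast
qed

lemma min_singular_value_transpose: "min_singular_value (transpose K) = min_singular_value K"
  unfolding min_singular_value_def
  using singular_value_set_transpose_subset[of K] singular_value_set_transpose_subset[of "transpose K"]
  by (intro arg_cong[where f = Min]) (simp only: transpose_transpose subset_antisym)

lemma min_singular_value_bound:
  fixes K :: "real^'n^'m"
  assumes inj: "inj ((*v) K)"
  shows "0 < min_singular_value K"
    and "(min_singular_value K)\<^sup>2 * (x \<bullet> x) \<le> (K *v x) \<bullet> (K *v x)"
proof -
  define f where "f = (\<lambda>x. (transpose K ** K) *v x)"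
  define \<Sigma> where "\<Sigma> = {\<sigma>. 0 < \<sigma> \<and> (\<exists>x. x \<noteq> 0 \<and> f x = \<sigma>\<^sup>2 *\<^sub>R x)}"
  have lf: "linear f" unfolding f_def by (rule matrix_vector_mul_linear)
  have fi: "f x \<bullet> y = (K *v x) \<bullet> (K *v y)" for x y unfolding f_def by (rule gram_inner)
  have sym: "f x \<bullet> y = x \<bullet> f y" for x y using fi[of x y] fi[of y x] by (simp add: inner_commute)
  obtain E where E: "pairwise orthogonal E" "\<And>v. v \<in> E \<Longrightarrow> norm v = 1 \<and> (\<exists>l. f v = l *\<^sub>R v)"
    "span E = UNIV"
    using symmetric_spectral_theorem[OF lf sym subspace_UNIV] by auto
  have "0 \<notin> E" using E(2) by force
  then have "finite E" using pairwise_orthogonal_independent[OF E(1)] independent_imp_finite by blast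
  \<comment> \<open>Finiteness is needed for \<open>Min\<close> to be meaningful. An eigenvector is
    not orthogonal to some basis vector, and by symmetry the two share their eigenvalue.\<close>
  moreover have "\<Sigma> \<subseteq> (\<lambda>v. sqrt (f v \<bullet> v)) ` E"
  proof
    fix \<sigma> assume "\<sigma> \<in> \<Sigma>"
    then obtain x where x: "0 < \<sigma>" "x \<noteq> 0" "f x = \<sigma>\<^sup>2 *\<^sub>R x" by (auto simp: \<Sigma>_def)
    have "\<exists>v\<in>E. x \<bullet> v \<noteq> 0"
    proof (rule ccontr)
      assume "\<not> ?thesis"
      then have "orthogonal x x" using E(3)
        by (intro orthogonal_to_span[of x E]) (auto simp: orthogonal_def)
      then show False using x(2) by (simp add: orthogonal_def)
    qed
    then obtain v l where v: "v \<in> E" "x \<bullet> v \<noteq> 0" "f v = l *\<^sub>R v" "norm v = 1" using E(2) by blast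
    have "\<sigma>\<^sup>2 * (x \<bullet> v) = l * (x \<bullet> v)" using sym[of x v] by (simp add: x(3) v(3))
    then have "f v \<bullet> v = \<sigma>\<^sup>2" using v by (simp add: dot_square_norm)
    then have "\<sigma> = sqrt (f v \<bullet> v)" using x(1) by simp
    with v(1) show "\<sigma> \<in> (\<lambda>v. sqrt (f v \<bullet> v)) ` E" by blast
  qed
  ultimately have fin: "finite \<Sigma>" by (rule finite_surj)
  \<comment> \<open>Maximizing for the negated map yields the smallest eigenvalue \<open>- l\<close>
    of the Gram matrix, positive by injectivity.\<close>
  obtain z l where z: "norm z = 1" "- f z = l *\<^sub>R z" "\<And>y. - f y \<bullet> y \<le> l * (y \<bullet> y)"
  proof -
    have l: "linear (\<lambda>x. - f x)" using lf by (rule linear_compose_neg)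
    have s: "- f x \<bullet> y = x \<bullet> - f y" for x y by (simp add: sym)
    have "(UNIV :: (real^'n) set) \<noteq> {0}"
      using axis_eq_0_iff[of undefined "1::real"] by (metis UNIV_I singletonD zero_neq_one)
    from symmetric_rayleigh_max[OF l s subspace_UNIV _ this] show ?thesis using that by auto
  qed
  have zz: "z \<bullet> z = 1" using z(1) by (simp add: dot_square_norm)
  have fz: "f z = (- l) *\<^sub>R z" using arg_cong[OF z(2), of uminus] by simp
  have "K *v z \<noteq> 0"
  proof
    assume "K *v z = 0"
    then have "z = 0" using inj by (metis injD matrix_vector_mult_0_right)
    then show False using zz by simp
  qed
  then have "0 < f z \<bullet> z" unfolding fi by simp
  then have l: "0 < - l" by (simp add: fz zz)
  define s where "s = sqrt (- l)"
  have s: "0 < s" "s\<^sup>2 = - l" using l by (simp_all add: s_def)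
  have "z \<noteq> 0" using zz by auto
  then have sS: "s \<in> \<Sigma>" unfolding \<Sigma>_def using s fz by auto
  have M: "min_singular_value K = Min \<Sigma>" by (simp add: min_singular_value_def \<Sigma>_def f_def)
  have "Min \<Sigma> \<in> \<Sigma>" using fin sS by (intro Min_in) auto
  then show pos: "0 < min_singular_value K" unfolding M by (simp add: \<Sigma>_def)
  have "min_singular_value K \<le> s" unfolding M using fin sS by simp
  then have "(min_singular_value K)\<^sup>2 \<le> s\<^sup>2" using pos by (intro power_mono) auto
  then have "(min_singular_value K)\<^sup>2 * (x \<bullet> x) \<le> - l * (x \<bullet> x)"
    unfolding s(2) by (intro mult_right_mono) auto
  also have "\<dots> \<le> f x \<bullet> x" using z(3)[of x] by simp
  finally show "(min_singular_value K)\<^sup>2 * (x \<bullet> x) \<le> (K *v x) \<bullet> (K *v x)" by (simp add: fi)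
qed

lemma mat_infnorm_bound:
  fixes K :: "real^'n^'m"
  shows "infnorm (K *v x) \<le> mat_infnorm K * infnorm x"
proof (cases "x = 0")
  case False
  \<comment> \<open>The supremum in \<open>mat_infnorm\<close> can be used only once the set is
    bounded; this follows by comparison with the Euclidean norm.\<close>
  have bdd: "bdd_above {infnorm (K *v x) |x. infnorm x = 1}"
  proof (rule bdd_aboveI)
    fix r assume "r \<in> {infnorm (K *v x) |x. infnorm x = 1}"
    then obtain x where x: "r = infnorm (K *v x)" "infnorm x = 1" by blast
    have "r \<le> norm (K *v x)" unfolding x(1) by (rule infnorm_le_norm)
    also have "\<dots> \<le> onorm ((*v) K) * norm x"
      by (intro onorm matrix_vector_mul_bounded_linear)
    also have "\<dots> \<le> onorm ((*v) K) * (sqrt DIM(real^'n) * infnorm x)"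
      by (intro mult_left_mono norm_le_infnorm onorm_pos_le matrix_vector_mul_bounded_linear)
    finally show "r \<le> onorm ((*v) K) * sqrt DIM(real^'n)" by (simp add: x(2))
  qed
  define n where "n = infnorm x"
  have n: "0 < n" using False by (simp add: n_def infnorm_pos_lt)
  have "infnorm ((1 / n) *\<^sub>R x) = 1" using n by (simp only: infnorm_mul) (simp add: n_def)
  then have "infnorm (K *v ((1 / n) *\<^sub>R x)) \<le> mat_infnorm K"
    unfolding mat_infnorm_def by (intro cSup_upper bdd) blast
  then have "(1 / n) * infnorm (K *v x) \<le> mat_infnorm K"
    using n by (simp add: matrix_vector_mult_scaleR infnorm_mul)
  then show ?thesis using n by (simp add: n_def field_simps)
qed (simp add: infnorm_0)

text \<open>
  The form \<open>Q y = \<parallel>A y\<parallel>\<^sup>2\<close> dominates \<open>c (y\<^sub>j\<^sub>0)\<^sup>2\<close> for all \<open>y\<close>, and adding a constant \<open>t\<close> to a centered \<open>y\<close>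
  adds \<open>t\<^sup>2\<close> to \<open>Q y\<close>; the value of \<open>t\<close> below optimizes the resulting bound on centered vectors.
\<close>

lemma delta_1_le:
  fixes K :: "real^'n^'m"
  assumes n: "2 \<le> CARD('n)" and K: "positive_mat K" "inj ((*v) K)"
    and a: "probability_vec a" "positive_vec a" and b: "probability_vec b" "positive_vec b"
    and sol: "sinkhorn_solution K a b u v"
    and q: "\<And>y. (\<Sum>j\<in>UNIV. b $ j * y $ j) = 0 \<Longrightarrow>
      (\<Sum>i\<in>UNIV. a $ i * (row_average (\<chi> i j. u $ i * K $ i $ j * v $ j) a y $ i)\<^sup>2)
        \<le> q * (\<Sum>j\<in>UNIV. b $ j * (y $ j)\<^sup>2)"
  shows "delta_1 K a b \<le> q"
proof -
  have u: "0 < u $ i" and v: "0 < v $ j" and uK: "u $ i * (K *v v) $ i = a $ i"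
    and vK: "v $ j * (transpose K *v u) $ j = b $ j" for i j
    using sol by (auto simp: sinkhorn_solution_def positive_vec_def)
  define P where "P = (\<chi> i j. u $ i * K $ i $ j * v $ j)"
  have "(\<Sum>j\<in>UNIV. P $ i $ j) = a $ i" for i
    unfolding uK[symmetric] by (simp add: P_def matrix_vector_mult_def sum_distrib_left mult_ac)
  moreover have "(\<Sum>i\<in>UNIV. P $ i $ j) = b $ j" for j
    unfolding vK[symmetric] by (simp add: P_def matrix_vector_mult_def transpose_def sum_distrib_left mult_ac)
  ultimately interpret coupling P a b
    using u v K(1) a(1) by unfold_locales (simp_all add: P_def positive_mat_def)
  define Q where "Q = (\<lambda>y. \<Sum>i\<in>UNIV. a $ i * (A y $ i)\<^sup>2)"
  define N where "N = mat_infnorm K"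
  define \<sigma> where "\<sigma> = min_singular_value K"
  define a0 where "a0 = min_entry a"
  have "a0 \<in> range (\<lambda>i. a $ i)" unfolding a0_def min_entry_def by (intro Min_in) auto
  then have a0: "0 < a0" "a0 \<le> a $ i" for i using a_pos by (auto simp: a0_def min_entry_def)
  obtain j0 where j0: "\<And>j. v $ j \<le> v $ j0"
  proof -
    have "Max (range (\<lambda>j. v $ j)) \<in> range (\<lambda>j. v $ j)" by (intro Max_in) auto
    then obtain j0 where "Max (range (\<lambda>j. v $ j)) = v $ j0" by (rule imageE)
    moreover have "v $ j \<le> Max (range (\<lambda>j. v $ j))" for j by simp
    ultimately show ?thesis using that by metis
  qed
  have infv: "infnorm v = v $ j0"
    unfolding infnorm_cart using j0 v by (intro cSup_eq_maximum) (auto simp: less_imp_le)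
  have Kv0: "0 < (K *v v) $ i" for i
    using positive_mat_vec[OF K(1)] v by (simp add: positive_vec_def)
  have Kv: "(K *v v) $ i \<le> N * v $ j0" for i
    using component_le_infnorm_cart[of "K *v v" i] mat_infnorm_bound[of K v]
    by (simp add: infv N_def)
  have "0 < N * v $ j0" using Kv0 Kv by (rule less_le_trans)
  then have N: "0 < N" using v[of j0] by (simp add: zero_less_mult_iff)
  have \<sigma>: "0 < \<sigma>" unfolding \<sigma>_def by (rule min_singular_value_bound[OF K(2)])
  \<comment> \<open>\<open>A y\<close> is the quotient of \<open>K *v (v * y)\<close> by
    \<open>K *v v\<close>. The numerator is controlled by \<sigma>, the denominator by
    \<open>N * v $ j0\<close> as \<open>v $ j0\<close> is the infinity norm of \<open>v\<close>; the
    weights are at least \<open>a0\<close>.\<close>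
  define c where "c = a0 * (\<sigma> / N)\<^sup>2"
  have c: "0 < c" using a0 \<sigma> N by (simp add: c_def)
  have Qv: "c / (v $ j0)\<^sup>2 * (\<Sum>j\<in>UNIV. (v $ j * y $ j)\<^sup>2) \<le> Q y" for y
  proof -
    define w where "w = K *v (v * y)"
    have Aw: "A y $ i = w $ i / (K *v v) $ i" for i
    proof -
      have "(\<Sum>j\<in>UNIV. P $ i $ j * y $ j) = u $ i * w $ i"
        by (simp add: P_def w_def matrix_vector_mult_def sum_distrib_left mult_ac)
      then show ?thesis unfolding row_average_def uK[symmetric] using u[of i] by simp
    qed
    have "c / (v $ j0)\<^sup>2 * (\<Sum>j\<in>UNIV. (v $ j * y $ j)\<^sup>2) =
        a0 / (N * v $ j0)\<^sup>2 * (\<sigma>\<^sup>2 * ((v * y) \<bullet> (v * y)))"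
      by (simp add: c_def inner_vec_def power_mult_distrib power_divide flip: power2_eq_square)
    also have "\<dots> \<le> a0 / (N * v $ j0)\<^sup>2 * (w \<bullet> w)"
      unfolding \<sigma>_def w_def using a0 by (intro mult_left_mono min_singular_value_bound[OF K(2)]) simp
    also have "\<dots> = (\<Sum>i\<in>UNIV. a0 * ((w $ i)\<^sup>2 / (N * v $ j0)\<^sup>2))"
      by (simp add: inner_vec_def sum_distrib_left flip: power2_eq_square)
    also have "\<dots> \<le> Q y"
      unfolding Q_def
    proof (rule sum_mono)
      fix i
      have "(w $ i)\<^sup>2 / (N * v $ j0)\<^sup>2 \<le> (w $ i)\<^sup>2 / ((K *v v) $ i)\<^sup>2"
        using Kv[of i] Kv0[of i] by (intro divide_left_mono power_mono mult_pos_pos) auto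
      then show "a0 * ((w $ i)\<^sup>2 / (N * v $ j0)\<^sup>2) \<le> a $ i * (A y $ i)\<^sup>2"
        unfolding Aw power_divide using a0 by (intro mult_mono) (auto simp: less_imp_le[OF a_pos])
    qed
    finally show ?thesis .
  qed
  have Qj: "c * (y $ j0)\<^sup>2 \<le> Q y" for y
  proof -
    have "(v $ j0 * y $ j0)\<^sup>2 \<le> (\<Sum>j\<in>UNIV. (v $ j * y $ j)\<^sup>2)" by (rule member_le_sum) auto
    then have "c / (v $ j0)\<^sup>2 * (v $ j0 * y $ j0)\<^sup>2 \<le> c / (v $ j0)\<^sup>2 * (\<Sum>j\<in>UNIV. (v $ j * y $ j)\<^sup>2)"
      using c by (intro mult_left_mono) auto
    also have "\<dots> \<le> Q y" by (rule Qv)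
    finally show ?thesis using v[of j0] by (simp add: power_mult_distrib)
  qed
  have "UNIV \<noteq> {j0}" using n by (auto dest: arg_cong[of _ _ card])
  then obtain j1 where j1: "j1 \<noteq> j0" by blast
  \<comment> \<open>Tested on the constant 1, where \<open>Q\<close> equals 1; a second positive
    entry of \<open>v\<close> makes the inequality strict.\<close>
  have c1: "c < 1"
  proof -
    have "(\<Sum>j\<in>{j0, j1}. (v $ j)\<^sup>2) \<le> (\<Sum>j\<in>UNIV. (v $ j)\<^sup>2)" by (rule sum_mono2) auto
    moreover have "(\<Sum>j\<in>{j0, j1}. (v $ j)\<^sup>2) = (v $ j0)\<^sup>2 + (v $ j1)\<^sup>2" using j1 by simp
    moreover have "0 < (v $ j1)\<^sup>2" using v[of j1] by simp
    ultimately have "(v $ j0)\<^sup>2 < (\<Sum>j\<in>UNIV. (v $ j)\<^sup>2)" by linarith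
    then have "c / (v $ j0)\<^sup>2 * (v $ j0)\<^sup>2 < c / (v $ j0)\<^sup>2 * (\<Sum>j\<in>UNIV. (v $ j)\<^sup>2)"
      using c v[of j0] by (intro mult_strict_left_mono) auto
    also have "\<dots> \<le> Q (\<chi> j. 1)" using Qv[of "\<chi> j. 1"] by simp
    also have "\<dots> = 1" by (simp add: Q_def A_one sum_a)
    finally show ?thesis using v[of j0] by simp
  qed
  define b0 where "b0 = b $ j0"
  have b0: "0 < b0" by (simp add: b0_def b_pos)
  have b1: "b $ j < 1" for j
  proof -
    define k where "k = (if j = j0 then j1 else j0)"
    have k: "k \<noteq> j" using j1 by (simp add: k_def)
    have "(\<Sum>j\<in>{j, k}. b $ j) \<le> (\<Sum>j\<in>UNIV. b $ j)"
      by (rule sum_mono2) (auto simp: less_imp_le[OF b_pos])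
    then show ?thesis using k b_pos[of k] by (simp add: sum_b)
  qed
  \<comment> \<open>The centered indicator of \<open>j0\<close>.\<close>
  define y where "y = (\<chi> j. (if j = j0 then 1 else 0) - b0)"
  have ym: "(\<Sum>j\<in>UNIV. b $ j * y $ j) = 0"
  proof -
    have "b $ j * y $ j = (if j = j0 then b0 else 0) - b0 * b $ j" for j
      by (simp add: y_def b0_def algebra_simps)
    then show ?thesis by (simp add: sum_subtractf sum_b flip: sum_distrib_left)
  qed
  have yn: "(\<Sum>j\<in>UNIV. b $ j * (y $ j)\<^sup>2) = b0 * (1 - b0)"
  proof -
    have "b $ j * (y $ j)\<^sup>2 = (if j = j0 then b0 else 0) - b0 * (b $ j * y $ j) - b0 * (if j = j0 then b0 else 0)" for j
      by (simp add: y_def b0_def power2_eq_square algebra_simps)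
    then show ?thesis
      by (simp only: sum_subtractf sum_distrib_left[symmetric] ym) (simp add: algebra_simps)
  qed
  define t where "t = c * (1 - b0) / (1 - c)"
  have "Q (y + (\<chi> j. t)) = Q y + t\<^sup>2"
  proof -
    have "a $ i * (A (y + (\<chi> j. t)) $ i)\<^sup>2 = a $ i * (A y $ i)\<^sup>2 + 2 * t * (a $ i * A y $ i) + t\<^sup>2 * a $ i" for i
      by (simp add: linear_add[OF linear_row_average] A_one power2_eq_square algebra_simps)
    then have "Q (y + (\<chi> j. t)) = Q y + 2 * t * (\<Sum>i\<in>UNIV. a $ i * A y $ i) + t\<^sup>2 * (\<Sum>i\<in>UNIV. a $ i)"
      by (simp add: Q_def sum.distrib sum_distrib_left)
    then show ?thesis by (simp add: A_mean ym sum_a)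
  qed
  then have "c * (1 - b0 + t)\<^sup>2 - t\<^sup>2 \<le> Q y" using Qj[of "y + (\<chi> j. t)"] by (simp add: y_def)
  also have "1 - b0 + t = (1 - b0) / (1 - c)" using c1 by (simp add: t_def field_simps)
  also have "c * ((1 - b0) / (1 - c))\<^sup>2 - t\<^sup>2 = c / (1 - c) * (1 - b0)\<^sup>2"
  proof -
    define d where "d = (1 - b0) / (1 - c)"
    have d: "1 - b0 = d * (1 - c)" "t = c * d" using c1 by (simp_all add: d_def t_def)
    have "c * d\<^sup>2 - (c * d)\<^sup>2 = c * d\<^sup>2 * (1 - c)" by (simp add: power2_eq_square algebra_simps)
    also have "\<dots> = c / (1 - c) * (d * (1 - c))\<^sup>2" using c1 by (simp add: power2_eq_square)
    finally show ?thesis unfolding d_def[symmetric] by (simp only: d)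
  qed
  also have "Q y \<le> q * (b0 * (1 - b0))"
    unfolding Q_def yn[symmetric] using q[OF ym] by (simp add: P_def)
  finally have "(c / (1 - c) * (1 - b0)) * (1 - b0) \<le> (q * b0) * (1 - b0)"
    by (simp add: power2_eq_square mult_ac)
  then have "c / (1 - c) * (1 - b0) \<le> q * b0" 
    by (rule mult_right_le_imp_le) (simp add: b0_def b1)
  then have qb: "c / (1 - c) * ((1 - b0) / b0) \<le> q"
    using pos_divide_le_eq[OF b0] by (simp only: times_divide_eq_right)
  define bm where "bm = max_entry b"
  have bm: "b0 \<le> bm" by (simp add: bm_def b0_def max_entry_def)
  \<comment> \<open>The largest entry of \<open>b\<close> may sit at another index than
    \<open>j0\<close>, but \<open>(1 - s) / s\<close> decreases in \<open>s > 0\<close>.\<close>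
  have "(1 - bm) / bm \<le> (1 - b0) / b0" using bm b0 by (simp add: field_simps)
  then have "c / (1 - c) * ((1 - bm) / bm) \<le> c / (1 - c) * ((1 - b0) / b0)"
    using c c1 by (intro mult_left_mono) auto
  moreover have "delta_1 K a b = c / (1 - c) * ((1 - bm) / bm)"
  proof -
    have "(N / \<sigma>)\<^sup>2 - a0 = a0 * ((1 - c) / c)"
      using c a0 \<sigma> N by (simp add: c_def power_divide field_simps)
    then show ?thesis
      unfolding delta_1_def N_def[symmetric] \<sigma>_def[symmetric] a0_def[symmetric] bm_def[symmetric]
      using a0(1) by (simp add: mult.commute)
  qed
  ultimately show ?thesis using qb by simp
qed

text \<open>Reduces the wide case to the tall one, with \<open>u\<close> and \<open>v\<close>
  exchanged.\<close>

lemma delta_2_eq: "delta_2 K a b = delta_1 (transpose K) b a"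
  by (simp add: delta_1_def delta_2_def min_singular_value_transpose)

theorem theorem2:
  fixes K :: "real^'n^'m" and a :: "real^'m" and b :: "real^'n"
  assumes "min CARD('m) CARD('n) \<ge> 2"
    and "probability_vec a" and "positive_vec a"
    and "probability_vec b" and "positive_vec b"
    and "positive_mat K"
    and "rank K = min CARD('m) CARD('n)"
  shows "(\<forall>\<omega>::real. 1 < \<omega> \<and> \<omega> < 1 + theta_squared K a b \<longrightarrow>
            local_rate \<omega> K a b < local_rate 1 K a b) \<and>
         (\<forall>\<omega>::real. 1 < \<omega> \<and> \<omega> < min (1 + delta K a b) (2 / (1 + birkhoff_ratio K)) \<longrightarrow>
            globally_convergent \<omega> K a b \<and> local_rate \<omega> K a b < local_rate 1 K a b)"
proof -
  note a = assms(2,3) and b = assms(4,5) and K = assms(6)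
  have mn: "2 \<le> CARD('m)" "2 \<le> CARD('n)" using assms(1) by simp_all
  define P where "P = sinkhorn_plan K a b"
  interpret coupling P a b unfolding P_def by (rule sinkhorn_plan_coupling[OF K a b])
  obtain u v where uv: "sinkhorn_sol K a b = (u, v)" by (meson surj_pair)
  then have sol: "sinkhorn_solution K a b u v"
    using sinkhorn_sol_solution[OF K a b] by simp
  then have sol': "sinkhorn_solution (transpose K) b a v u"
    by (simp only: sinkhorn_solution_def transpose_transpose)
  have P: "P = (\<chi> i j. u $ i * K $ i $ j * v $ j)"
    by (simp add: P_def sinkhorn_plan_nth uv)
  have Pt: "transpose P = (\<chi> j i. v $ j * transpose K $ j $ i * u $ i)"
    by (simp add: P transpose_def vec_eq_iff mult_ac)
  obtain q x where second: "second_largest_eigenvalue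
      (diag_mat (vec_divide 1 a) ** P ** diag_mat (vec_divide 1 b) ** transpose P) = q"
    and q: "0 \<le> q" "q < 1" and x: "(\<Sum>i\<in>UNIV. a $ i * x $ i) = 0" "x \<noteq> 0" "A (B x) = q *\<^sub>R x"
    and Bq: "\<And>x. (\<Sum>i\<in>UNIV. a $ i * x $ i) = 0 \<Longrightarrow>
      (\<Sum>j\<in>UNIV. b $ j * (B x $ j)\<^sup>2) \<le> q * (\<Sum>i\<in>UNIV. a $ i * (x $ i)\<^sup>2)"
    by (rule second_largest_eigenvalue_coupling[OF mn(1)]) (rule that; (assumption | blast))
  have th: "theta_squared K a b = q" unfolding theta_squared_def P_def[symmetric] by (rule second)
  note Aq = dual_quadratic_bound[OF q(1) Bq]
  have rate: "local_rate \<omega> K a b < local_rate 1 K a b" if \<omega>: "1 < \<omega>" "\<omega> < 1 + q" for \<omega>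
  proof -
    have "0 < q" using \<omega> by simp
    from spectral_radius_over_relaxation[OF this q(2) Aq x \<omega>] show ?thesis
      by (simp add: local_rate_eq[OF K a b] P_def)
  qed
  have 1: "delta_1 K a b \<le> q" if "CARD('n) \<le> CARD('m)"
  proof -
    \<comment> \<open>Here the rank is the number of columns, so \<open>K\<close> is injective; in
      the other case the same holds for its transpose.\<close>
    have "inj ((*v) K)" using assms(7) that by (simp add: min_def flip: full_rank_injective)
    from delta_1_le[OF mn(2) K this a b sol] show ?thesis using Aq unfolding P by blast
  qed
  have 2: "delta_2 K a b \<le> q" if "CARD('m) \<le> CARD('n)"
  proof -
    have "inj ((*v) (transpose K))"
      using assms(7) that by (simp add: rank_transpose min_def flip: full_rank_injective)
    from delta_1_le[OF mn(1) positive_mat_transpose[OF K] this b a sol'] show ?thesis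
      using Bq unfolding Pt delta_2_eq by blast
  qed
  have "delta K a b \<le> q" using 1 2 by (auto simp: delta_def)
  then show ?thesis
    using rate globally_convergent_over_relaxation[OF K a b] unfolding th by auto
qed

end
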